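(* Suppose $\sigma\colon X\to \mathcal H$ is a uniformly continuous map from a separable Banach space $X$ into a Hilbert space $\mathcal H$ so that, for some single $r>0$, $$ \inf_{\|x-y\|=r}\|\sigma(x)-\sigma(y)\|>0. $$ Then $B_X$ uniformly embeds into $B_{\mathcal H}$.
   Context: $B_X$ and $B_{\mathcal H}$ denote the unit balls, with the norm metrics. A map $\phi\colon (A,d)\to(B,\partial)$ between metric spaces is a uniform embedding if it is uniformly continuous and $\inf\{\partial(\phi(a),\phi(a')):d(a,a')\geqslant t\}>0$ for every $t>0$. *)

theory Defs
  imports "HOL-Analysis.Analysis"
begin

(* The infima are taken in the extended reals, so that an infimum over the empty set is \<infinity>
   (e.g. when t exceeds the diameter of A). *)

definition uniform_embedding ::
    "'a::metric_space set \<Rightarrow> 'b::metric_space set \<Rightarrow> ('a \<Rightarrow> 'b) \<Rightarrow> bool" where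
  "uniform_embedding A B \<phi> \<longleftrightarrow>
     \<phi> \<in> A \<rightarrow> B \<and> uniformly_continuous_on A \<phi> \<and>
     (\<forall>t>0. (INF (a, a') \<in> {(a, a'). a \<in> A \<and> a' \<in> A \<and> dist a a' \<ge> t}.
               ereal (dist (\<phi> a) (\<phi> a'))) > 0)"

definition uniformly_embeds :: "'a::metric_space set \<Rightarrow> 'b::metric_space set \<Rightarrow> bool" where
  "uniformly_embeds A B \<longleftrightarrow> (\<exists>\<phi>. uniform_embedding A B \<phi>)"

end

theory Submission
  imports Defs "HOL-Complex_Analysis.Great_Picard"
begin

text \<open>
  If \<open>H\<close> is infinite-dimensional, the displacements \<open>\<parallel>\<sigma>(x + z) - \<sigma>(y + z)\<parallel>\<^sup>2\<close> are averaged over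
  \<open>z\<close> with respect to an invariant mean of a countable dense subgroup \<open>G\<close> of \<open>X\<close>. The average is
  the squared distance \<open>\<parallel>\<phi> x - \<phi> y\<parallel>\<^sup>2\<close> for a map \<open>\<phi>\<close> from \<open>G\<close> to \<open>H\<close>,
  and is invariant under translations. If \<open>u = x - y\<close> is short, some multiple \<open>n u\<close> has norm close to \<open>r\<close>, so the triangle inequality and
  invariance give \<open>\<delta> \<le> \<parallel>\<phi>(n u) - \<phi> 0\<parallel> \<le> n \<parallel>\<phi> x - \<phi> y\<parallel>\<close> with \<open>n \<le> r / \<parallel>u\<parallel>\<close>. Hence \<open>\<phi>\<close> has a
  linear lower bound at small distances, and its extension to \<open>X\<close> embeds a small ball.

  If \<open>dim H = m\<close> is finite, then \<open>dim X \<le> m\<close> and a linear injection suffices. Indeed, were there \<open>m + 1\<close>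
  independent vectors in \<open>X\<close>, colour a large cube in their span with \<open>m + 1\<close> colours, according to which
  of \<open>m + 1\<close> disjoint ranges is avoided by the distances of all \<open>m\<close> coordinates of \<open>\<sigma>\<close>
  to a fine lattice. By the Hex theorem, some colour \<open>i\<close> has a chain joining the two faces orthogonal
  to direction \<open>i\<close>. On such a chain \<open>\<sigma>\<close> is nearly constant, although the chain contains points
  at distance about \<open>r\<close>.
\<close>

subsection \<open>A Hex theorem for maps lowering the dimension\<close>

text \<open>The numbers whose distance to the integers differs from \<open>c\<close> by at least
  \<open>u\<close> form closed intervals of length at most 1, centred at the integers and at the
  midpoints between them. The gaps have length \<open>2 * u\<close>, so a step of length at most
  \<open>u\<close> between two such numbers cannot leave an interval.\<close>

lemma far_from_lattice_invariant_interval: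
  fixes y c u :: real
  assumes u: "0 < u" and c: "u < c" "c + u < 1/2"
    and y: "u \<le> \<bar>\<bar>y - of_int (round y)\<bar> - c\<bar>"
  obtains lo hi where "lo \<le> y" "y \<le> hi" "hi - lo \<le> 1"
    and "\<And>z w. \<lbrakk>lo \<le> z; z \<le> hi; \<bar>w - z\<bar> \<le> u; u \<le> \<bar>\<bar>w - of_int (round w)\<bar> - c\<bar>\<rbrakk>
           \<Longrightarrow> lo \<le> w \<and> w \<le> hi"
proof (cases "\<bar>y - of_int (round y)\<bar> \<le> c - u")
  case True
  let ?n = "of_int (round y) :: real"
  have step: "?n - (c - u) \<le> w \<and> w \<le> ?n + (c - u)"
    if "?n - (c - u) \<le> z" "z \<le> ?n + (c - u)" "\<bar>w - z\<bar> \<le> u"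
      "u \<le> \<bar>\<bar>w - of_int (round w)\<bar> - c\<bar>" for z w
  proof -
    have w: "\<bar>w - ?n\<bar> \<le> c" using that by linarith
    then have "round w = round y" using u c by (intro round_unique') linarith
    with w that(4) u show ?thesis by (auto simp: abs_le_iff abs_if split: if_splits)
  qed
  show ?thesis
  proof (rule that)
    show "?n - (c - u) \<le> y" "y \<le> ?n + (c - u)" "?n + (c - u) - (?n - (c - u)) \<le> 1"
      using True u c by linarith+
  qed (fact step)
next
  case False
  with y have far: "c + u \<le> \<bar>y - of_int (round y)\<bar>" by linarith
  let ?n = "of_int \<lfloor>y\<rfloor> :: real"
  have int: "\<bar>v - of_int (round v)\<bar> \<le> v - ?n" "\<bar>v - of_int (round v)\<bar> \<le> ?n + 1 - v"
    if "?n \<le> v" "v \<le> ?n + 1" for v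
    using round_diff_minimal[of v "\<lfloor>y\<rfloor>"] round_diff_minimal[of v "\<lfloor>y\<rfloor> + 1"] that by auto
  have y': "?n \<le> y" "y \<le> ?n + 1" by linarith+
  have step: "?n + (c + u) \<le> w \<and> w \<le> ?n + 1 - (c + u)"
    if z: "?n + (c + u) \<le> z" "z \<le> ?n + 1 - (c + u)" "\<bar>w - z\<bar> \<le> u"
      and w: "u \<le> \<bar>\<bar>w - of_int (round w)\<bar> - c\<bar>" for z w
  proof -
    have *: "?n + c \<le> w" "w \<le> ?n + 1 - c" using z by linarith+
    have "c \<le> \<bar>w - of_int (round w)\<bar>"
    proof (cases "round w \<le> \<lfloor>y\<rfloor>")
      case True
      then have "real_of_int (round w) \<le> ?n" by simp
      with * show ?thesis by linarith
    next
      case False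
      then have "?n + 1 \<le> real_of_int (round w)" by linarith
      with * show ?thesis by linarith
    qed
    with w u have "c + u \<le> \<bar>w - of_int (round w)\<bar>" by linarith
    with int[of w] * c u show ?thesis by linarith
  qed
  show ?thesis
  proof (rule that)
    show "?n + (c + u) \<le> y" "y \<le> ?n + 1 - (c + u)" "?n + 1 - (c + u) - (?n + (c + u)) \<le> 1"
      using far int[OF y'] u c by linarith+
  qed (fact step)
qed

text \<open>
  Pigeonhole: the \<open>m + 1\<close> open intervals of radius \<open>2u\<close> around the points \<open>(5j + 3)u\<close> are disjoint,
  so one of them contains none of the \<open>m\<close> numbers.
\<close>

lemma ex_lattice_distance_gap:
  fixes t :: "nat \<Rightarrow> real" and u :: real
  assumes u: "0 < u"
  shows "\<exists>j\<le>m. \<forall>k<m. 2 * u \<le> \<bar>t k - (5 * real j + 3) * u\<bar>"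
proof (rule ccontr)
  assume "\<not> ?thesis"
  then have "\<forall>j\<in>{..m}. \<exists>k\<in>{..<m}. \<bar>t k - (5 * real j + 3) * u\<bar> < 2 * u" by force
  then obtain \<kappa> where \<kappa>: "\<And>j. j \<in> {..m} \<Longrightarrow> \<kappa> j \<in> {..<m} \<and> \<bar>t (\<kappa> j) - (5 * real j + 3) * u\<bar> < 2 * u"
    by metis
  have "inj_on \<kappa> {..m}"
  proof (rule inj_onI)
    fix i j assume ij: "i \<in> {..m}" "j \<in> {..m}" "\<kappa> i = \<kappa> j"
    have "\<bar>(5 * real i + 3) * u - (5 * real j + 3) * u\<bar> < 4 * u"
      using \<kappa>[OF ij(1)] \<kappa>[OF ij(2)] unfolding ij(3) by arith
    moreover have "(5 * real i + 3) * u - (5 * real j + 3) * u = 5 * u * (real i - real j)"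
      by (simp add: algebra_simps)
    ultimately have "\<bar>5 * (real i - real j)\<bar> * u < 4 * u"
      using u by (simp add: abs_mult mult_ac)
    then have "\<bar>5 * (real i - real j)\<bar> < 4" using u by simp
    then have "\<bar>real_of_int (int i - int j)\<bar> < 1" by simp
    then have "\<bar>int i - int j\<bar> < 1" by linarith
    then show "i = j" by linarith
  qed
  moreover have "\<kappa> ` {..m} \<subseteq> {..<m}" using \<kappa> by auto
  ultimately have "card {..m} \<le> card {..<m}" by (metis card_inj_on_le finite_lessThan)
  then show False by simp
qed

definition in_grid :: "nat \<Rightarrow> nat \<Rightarrow> (nat \<Rightarrow> nat) \<Rightarrow> bool" where
  "in_grid m p z \<longleftrightarrow> (\<forall>i\<le>m. z i \<le> p)"

text \<open>All coordinates may change by 1 at once, so that any two vertices of a unit cell are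
  adjacent.\<close>

definition adjacent :: "nat \<Rightarrow> (nat \<Rightarrow> nat) \<Rightarrow> (nat \<Rightarrow> nat) \<Rightarrow> bool" where
  "adjacent m z w \<longleftrightarrow> (\<forall>i\<le>m. z i \<le> w i + 1 \<and> w i \<le> z i + 1)"

text \<open>Along a chain of one colour, each coordinate of \<open>F\<close> is trapped in an
  interval of length at most 1. That some colour crosses the grid in its own direction is the Hex
  theorem, derived here from Kuhn's combinatorial lemma.\<close>

lemma hex_chain:
  fixes F :: "(nat \<Rightarrow> nat) \<Rightarrow> nat \<Rightarrow> real" and m p :: nat
  assumes p: "0 < p"
    and F: "\<And>z w k. \<lbrakk>in_grid m p z; in_grid m p w; adjacent m z w; k < m\<rbrakk>
      \<Longrightarrow> \<bar>F z k - F w k\<bar> \<le> 1 / (10 * real m + 10)"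
  obtains i a b where "i \<le> m" "in_grid m p a" "a i = 0" "b i = p"
    "(\<lambda>z w. in_grid m p w \<and> adjacent m z w \<and> (\<forall>k<m. \<bar>F w k - F a k\<bar> \<le> 1))\<^sup>*\<^sup>* a b"
proof -
  \<comment> \<open>With this \<open>u\<close> the \<open>m + 1\<close> centres \<open>c j\<close>,
    spaced by \<open>5 * u\<close>, keep a margin \<open>u\<close> inside the range from 0 to 1/2 of
    distances to the integers. It is also the bound on the change of \<open>F\<close> in one
    step.\<close>
  define u where "u = 1 / (10 * real m + 10)"
  define c where "c j = (5 * real j + 3) * u" for j :: nat
  define t where "t z k = \<bar>F z k - of_int (round (F z k))\<bar>" for z k
  \<comment> \<open>The margin is \<open>u\<close>, although the pigeonhole argument yields
    \<open>2 * u\<close>: the difference lets a whole cell inherit the colour of its corner.\<close>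
  define C where "C j z \<longleftrightarrow> (\<forall>k<m. u \<le> \<bar>t z k - c j\<bar>)" for j z
  have u: "0 < u" by (simp add: u_def)
  have c: "u < c j \<and> c j + u < 1/2" if "j \<le> m" for j
  proof -
    have "u * 1 < u * (5 * real j + 3)" using u by (intro mult_strict_left_mono) auto
    moreover have "(5 * real j + 4) * u \<le> (5 * real m + 4) * u" using that u by simp
    moreover have "(5 * real m + 4) * u < 1/2" by (simp add: u_def field_simps)
    ultimately show ?thesis by (simp add: c_def algebra_simps)
  qed
  have t_Lip: "\<bar>t z k - t w k\<bar> \<le> \<bar>F z k - F w k\<bar>" for z w k
    using round_diff_minimal[of "F z k" "round (F w k)"] round_diff_minimal[of "F w k" "round (F z k)"]
    unfolding t_def by linarith
  have stay: "\<forall>k<m. \<bar>F w k - F a k\<bar> \<le> 1"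
    if "(\<lambda>z w. in_grid m p w \<and> adjacent m z w \<and> C j w)\<^sup>*\<^sup>* a w"
      and j: "j \<le> m" and a: "in_grid m p a" "C j a" for j a w
  proof (intro allI impI)
    fix k assume k: "k < m"
    have "u \<le> \<bar>\<bar>F a k - of_int (round (F a k))\<bar> - c j\<bar>" using a k by (simp add: C_def t_def)
    from far_from_lattice_invariant_interval[OF u conjunct1[OF c[OF j]] conjunct2[OF c[OF j]] this]
    obtain lo hi where I: "lo \<le> F a k" "F a k \<le> hi" "hi - lo \<le> 1"
      and inv: "\<And>z w. \<lbrakk>lo \<le> z; z \<le> hi; \<bar>w - z\<bar> \<le> u; u \<le> \<bar>\<bar>w - of_int (round w)\<bar> - c j\<bar>\<rbrakk>
           \<Longrightarrow> lo \<le> w \<and> w \<le> hi" by metis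
    from that(1) have "in_grid m p w \<and> lo \<le> F w k \<and> F w k \<le> hi"
    proof induction
      case base then show ?case using I a by simp
    next
      case (step z w)
      then show ?case
        using F[of z w k] inv[of "F z k" "F w k"] k
        by (auto simp: C_def t_def u_def abs_minus_commute)
    qed
    with I show "\<bar>F w k - F a k\<bar> \<le> 1" by linarith
  qed
  note found = that
  show thesis
  proof (rule ccontr)
    assume no: "\<not> thesis"
    define E where "E j w \<longleftrightarrow> (\<exists>a. in_grid m p a \<and> a j = 0 \<and> C j a \<and>
        (\<lambda>z w. in_grid m p w \<and> adjacent m z w \<and> C j w)\<^sup>*\<^sup>* a w)"
      for j w
    \<comment> \<open>Kuhn's labelling: coordinate \<open>j\<close> of a vertex records whether colour \<open>j\<close> connects it to the
      face \<open>z j = 0\<close>. If no colour crosses, the cell supplied by Kuhn's lemma is contradictory.\<close>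
    define label where "label w j = (if E j w \<or> w j = 0 then 0 else 1 :: nat)" for w j
    have E_far: False if Ew: "E j w" and j: "j \<le> m" and w: "w j = p" for j w
    proof -
      obtain a where a: "in_grid m p a" "a j = 0" "C j a"
        and ch: "(\<lambda>z w. in_grid m p w \<and> adjacent m z w \<and> C j w)\<^sup>*\<^sup>* a w"
        using Ew unfolding E_def by blast
      have "(\<lambda>z w. in_grid m p w \<and> adjacent m z w \<and> (\<forall>k<m. \<bar>F w k - F a k\<bar> \<le> 1))\<^sup>*\<^sup>* a w"
        using ch
      proof induction
        case (step y z)
        have "(\<lambda>z w. in_grid m p w \<and> adjacent m z w \<and> C j w)\<^sup>*\<^sup>* a z"
          by (rule rtranclp.rtrancl_into_rtrancl[OF step.hyps(1)]) (rule step.hyps(2))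
        from stay[OF this j a(1,3)] step.hyps(2)
        show ?case by (intro rtranclp.rtrancl_into_rtrancl[OF step.IH]) blast
      qed simp
      from found[OF j a(1,2) w this] no show False by blast
    qed
    \<comment> \<open>The boundary conditions of Kuhn's lemma: on the lower face the label is 0 by
      definition, on the upper face it is 1 because no colour crosses and \<open>p\<close> is
      positive.\<close>
    have label_p: "label w j = 1" if "j \<le> m" "w j = p" for w j
      using E_far that p by (auto simp: label_def)
    obtain q where q: "\<forall>i<Suc m. q i < p"
      and rs: "\<forall>i<Suc m. \<exists>r s. (\<forall>j<Suc m. q j \<le> r j \<and> r j \<le> q j + 1)
        \<and> (\<forall>j<Suc m. q j \<le> s j \<and> s j \<le> q j + 1) \<and> label r i \<noteq> label s i"
      by (rule kuhn_lemma[of p "Suc m" label])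
        (use p label_p in \<open>auto simp: label_def less_Suc_eq_le\<close>)
    \<comment> \<open>A colour of the corner \<open>q\<close> selects which of Kuhn's pairs
      \<open>r\<close>, \<open>s\<close> is used: label \<open>j\<close> will be constant on the
      cell.\<close>
    obtain j where j: "j \<le> m" and Cq: "\<forall>k<m. 2 * u \<le> \<bar>t q k - c j\<bar>"
      using ex_lattice_distance_gap[OF u, of m "t q"] unfolding c_def by blast
    obtain r s where r: "\<forall>i\<le>m. q i \<le> r i \<and> r i \<le> q i + 1" and s: "\<forall>i\<le>m. q i \<le> s i \<and> s i \<le> q i + 1"
      and lab: "label r j \<noteq> label s j"
      using rs j by (auto simp: less_Suc_eq_le)
    have cell: "in_grid m p v \<and> C j v" if v: "\<forall>i\<le>m. q i \<le> v i \<and> v i \<le> q i + 1" for v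
    proof -
      have "in_grid m p q" "in_grid m p v" "adjacent m v q" using q v unfolding in_grid_def adjacent_def
        by (auto simp: less_Suc_eq_le) (metis Suc_leI le_trans)+
      moreover have "u \<le> \<bar>t v k - c j\<bar>" if "k < m" for k
        using F[OF \<open>in_grid m p v\<close> \<open>in_grid m p q\<close> \<open>adjacent m v q\<close> that] t_Lip[of v k q] Cq that
        unfolding u_def[symmetric] by fastforce
      ultimately show ?thesis by (simp add: C_def)
    qed
    \<comment> \<open>A vertex on the face \<open>v j = 0\<close> starts a chain of length zero;
      otherwise an existing chain to \<open>v\<close> is prolonged by one step to
      \<open>w\<close>.\<close>
    have same: "E j w"
      if v: "\<forall>i\<le>m. q i \<le> v i \<and> v i \<le> q i + 1"
      and w: "\<forall>i\<le>m. q i \<le> w i \<and> w i \<le> q i + 1"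
      and Ev: "E j v \<or> v j = 0" for v w
    proof -
      have "adjacent m v w" unfolding adjacent_def
      proof (intro allI impI)
        fix i assume "i \<le> m"
        then have "q i \<le> v i" "v i \<le> q i + 1" "q i \<le> w i" "w i \<le> q i + 1" using v w by blast+
        then show "v i \<le> w i + 1 \<and> w i \<le> v i + 1" by linarith
      qed
      obtain a where a: "in_grid m p a" "a j = 0" "C j a"
        and ch: "(\<lambda>z w. in_grid m p w \<and> adjacent m z w \<and> C j w)\<^sup>*\<^sup>* a v"
        using Ev cell[OF v] unfolding E_def by blast
      have "(\<lambda>z w. in_grid m p w \<and> adjacent m z w \<and> C j w)\<^sup>*\<^sup>* a w"
        by (rule rtranclp.rtrancl_into_rtrancl[OF ch]) (use cell[OF w] \<open>adjacent m v w\<close> in blast)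
      with a show ?thesis unfolding E_def by blast
    qed
    show False using lab same[OF r s] same[OF s r] by (auto simp: label_def split: if_splits)
  qed
qed

subsection \<open>Finite-dimensional targets\<close>

lemma uniformly_continuous_normE:
  fixes f :: "'a::real_normed_vector \<Rightarrow> 'b::real_normed_vector"
  assumes "uniformly_continuous_on UNIV f" "0 < \<epsilon>"
  obtains \<theta> where "0 < \<theta>" "\<And>x y. norm (x - y) < \<theta> \<Longrightarrow> norm (f x - f y) < \<epsilon>"
proof -
  obtain \<theta> where "0 < \<theta>" "\<And>x y. dist x y < \<theta> \<Longrightarrow> dist (f x) (f y) < \<epsilon>"
    using assms unfolding uniformly_continuous_on_def by (meson UNIV_I)
  then show ?thesis using that by (simp add: dist_norm)
qed

text \<open>Both cases of the theorem end in a lower Lipschitz bound, which bounds the infimum at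
  scale \<open>t\<close> from below by \<open>\<alpha> * t\<close>.\<close>

lemma uniformly_embedsI:
  assumes "\<phi> \<in> A \<rightarrow> B" "uniformly_continuous_on A \<phi>" "0 < \<alpha>"
    and lower: "\<And>x y. \<lbrakk>x \<in> A; y \<in> A\<rbrakk> \<Longrightarrow> \<alpha> * dist x y \<le> dist (\<phi> x) (\<phi> y)"
  shows "uniformly_embeds A B"
  unfolding uniformly_embeds_def uniform_embedding_def
proof (intro exI conjI allI impI)
  fix t :: real assume t: "0 < t"
  have "0 < ereal (\<alpha> * t)" using t assms(3) by simp
  also have "\<dots> \<le> (INF (a, a') \<in> {(a, a'). a \<in> A \<and> a' \<in> A \<and> dist a a' \<ge> t}. ereal (dist (\<phi> a) (\<phi> a')))"
  proof (rule INF_greatest, clarify)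
    fix a a' assume "a \<in> A" "a' \<in> A" "t \<le> dist a a'"
    then have "\<alpha> * t \<le> \<alpha> * dist a a'" using assms(3) by simp
    also have "\<dots> \<le> dist (\<phi> a) (\<phi> a')" by (rule lower) fact+
    finally show "ereal (\<alpha> * t) \<le> ereal (dist (\<phi> a) (\<phi> a'))" by simp
  qed
  finally show "0 < (INF (a, a') \<in> {(a, a'). a \<in> A \<and> a' \<in> A \<and> dist a a' \<ge> t}. ereal (dist (\<phi> a) (\<phi> a')))" .
qed (use assms in auto)

section \<open>Coordinates in bases and orthonormal systems\<close>

text \<open>Compactness: otherwise there are coefficient vectors of l1-norm 1 whose combinations
  tend to 0, and the limit of a convergent subsequence is a nontrivial relation.\<close>

lemma coefficients_bounded_by_norm:
  fixes b :: "nat \<Rightarrow> 'x::real_normed_vector"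
  assumes indep: "\<And>c. (\<Sum>i<n. c i *\<^sub>R b i) = 0 \<Longrightarrow> \<forall>i<n. c i = 0"
  obtains \<kappa> where "0 < \<kappa>" "\<And>c i. i < n \<Longrightarrow> \<kappa> * \<bar>c i\<bar> \<le> norm (\<Sum>i<n. c i *\<^sub>R b i)"
proof -
  have "\<exists>\<kappa>>0. \<forall>c. \<forall>i<n. \<kappa> * \<bar>c i\<bar> \<le> norm (\<Sum>i<n. c i *\<^sub>R b i)"
  proof (rule ccontr)
    assume "\<not> ?thesis"
    then have bad: "\<exists>c. \<exists>i<n. norm (\<Sum>i<n. c i *\<^sub>R b i) < \<kappa> * \<bar>c i\<bar>" if "0 < \<kappa>" for \<kappa>
      using that by (force simp: not_le)
    have "\<exists>c. (\<Sum>i<n. \<bar>c i\<bar>) = 1 \<and> norm (\<Sum>i<n. c i *\<^sub>R b i) < inverse (real (Suc N))" for N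
    proof -
      obtain c j where c: "j < n" "norm (\<Sum>i<n. c i *\<^sub>R b i) < inverse (real (Suc N)) * \<bar>c j\<bar>"
        using bad[of "inverse (real (Suc N))"] by auto
      define s where "s = (\<Sum>i<n. \<bar>c i\<bar>)"
      have cs: "\<bar>c j\<bar> \<le> s" unfolding s_def using c(1) by (intro member_le_sum) auto
      have "0 < \<bar>c j\<bar>" using c(2) by (cases "c j = 0") auto
      then have s: "0 < s" using cs by linarith
      have "norm (\<Sum>i<n. (c i / s) *\<^sub>R b i) = norm (\<Sum>i<n. c i *\<^sub>R b i) / s"
      proof -
        have "(\<Sum>i<n. (c i / s) *\<^sub>R b i) = (1 / s) *\<^sub>R (\<Sum>i<n. c i *\<^sub>R b i)"
          by (simp add: scaleR_sum_right)
        then show ?thesis using s by simp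
      qed
      also have "\<dots> < inverse (real (Suc N)) * \<bar>c j\<bar> / s"
        using c(2) s by (simp add: divide_strict_right_mono)
      also have "\<dots> \<le> inverse (real (Suc N)) * s / s"
        using cs s by (intro divide_right_mono mult_left_mono) auto
      finally have "norm (\<Sum>i<n. (c i / s) *\<^sub>R b i) < inverse (real (Suc N))" using s by simp
      moreover have "(\<Sum>i<n. \<bar>c i / s\<bar>) = 1"
        using s by (simp add: abs_divide sum_divide_distrib[symmetric] s_def[symmetric])
      ultimately show ?thesis by (intro exI[of _ "\<lambda>i. c i / s"]) simp
    qed
    then obtain c where c1: "\<And>N. (\<Sum>i<n. \<bar>c N i\<bar>) = 1"
      and c0: "\<And>N. norm (\<Sum>i<n. c N i *\<^sub>R b i) < inverse (real (Suc N))" by metis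
    have "norm (c N i) \<le> 1" if "i \<in> {..<n}" for N i
      using c1[of N] member_le_sum[of i "{..<n}" "\<lambda>i. \<bar>c N i\<bar>"] that by auto
    then obtain k where k: "strict_mono (k :: nat \<Rightarrow> nat)"
      "\<And>i. i \<in> {..<n} \<Longrightarrow> \<exists>l. (\<lambda>N. c (k N) i) \<longlonglongrightarrow> l"
      using function_convergent_subsequence[of "{..<n}" c 1] by blast
    then obtain l where l: "\<And>i. i \<in> {..<n} \<Longrightarrow> (\<lambda>N. c (k N) i) \<longlonglongrightarrow> l i" by metis
    have "(\<lambda>N. \<Sum>i<n. \<bar>c (k N) i\<bar>) \<longlonglongrightarrow> (\<Sum>i<n. \<bar>l i\<bar>)"
      by (intro tendsto_sum tendsto_rabs l)
    then have l1: "(\<Sum>i<n. \<bar>l i\<bar>) = 1" using c1 LIMSEQ_unique[OF _ tendsto_const] by simp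
    have "(\<lambda>N. \<Sum>i<n. c (k N) i *\<^sub>R b i) \<longlonglongrightarrow> (\<Sum>i<n. l i *\<^sub>R b i)"
      by (intro tendsto_sum tendsto_scaleR l tendsto_const)
    moreover have "(\<lambda>N. \<Sum>i<n. c N i *\<^sub>R b i) \<longlonglongrightarrow> 0"
      by (rule Lim_null_comparison[OF _ LIMSEQ_inverse_real_of_nat])
         (use c0 in \<open>auto intro!: always_eventually less_imp_le\<close>)
    then have "(\<lambda>N. \<Sum>i<n. c (k N) i *\<^sub>R b i) \<longlonglongrightarrow> 0"
      using LIMSEQ_subseq_LIMSEQ[OF _ k(1)] by (fastforce simp: o_def)
    ultimately have "(\<Sum>i<n. l i *\<^sub>R b i) = 0" by (rule LIMSEQ_unique)
    with indep have "\<forall>i<n. l i = 0" by blast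
    with l1 show False by simp
  qed
  then show ?thesis using that by blast
qed

lemma independent_indexed:
  fixes b :: "nat \<Rightarrow> 'x::real_vector"
  assumes "independent B" "finite B" and b: "bij_betw b {..<n} B"
    and c: "(\<Sum>i<n. c i *\<^sub>R b i) = 0"
  shows "\<forall>i<n. c i = 0"
proof -
  have inj: "inj_on b {..<n}" using b by (simp add: bij_betw_def)
  have "(\<Sum>v\<in>B. c (the_inv_into {..<n} b v) *\<^sub>R v)
      = (\<Sum>i<n. c (the_inv_into {..<n} b (b i)) *\<^sub>R b i)"
    by (rule sum.reindex_bij_betw[OF b, symmetric])
  also have "\<dots> = (\<Sum>i<n. c i *\<^sub>R b i)"
    by (intro sum.cong) (auto simp: the_inv_into_f_f[OF inj])
  finally have "\<forall>v\<in>B. c (the_inv_into {..<n} b v) = 0"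
    using assms(1) c unfolding dependent_finite[OF assms(2)] by auto
  then show ?thesis using b by (auto simp: the_inv_into_f_f[OF inj] bij_betw_def)
qed

text \<open>The remainder lies in the span and is orthogonal to it, hence to itself.\<close>

lemma orthonormal_expansion:
  fixes e :: "nat \<Rightarrow> 'h::real_inner"
  assumes orth: "\<And>i j. \<lbrakk>i < m; j < m\<rbrakk> \<Longrightarrow> e i \<bullet> e j = (if i = j then 1 else 0)"
    and v: "v \<in> span (e ` {..<m})"
  shows "v = (\<Sum>i<m. (v \<bullet> e i) *\<^sub>R e i)"
proof -
  let ?w = "v - (\<Sum>i<m. (v \<bullet> e i) *\<^sub>R e i)"
  have "orthogonal ?w y" if y: "y \<in> e ` {..<m}" for y
  proof -
    obtain j where j: "j < m" "y = e j" using y by auto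
    have "(\<Sum>i<m. (v \<bullet> e i) * (e i \<bullet> e j)) = (\<Sum>i<m. if i = j then v \<bullet> e j else 0)"
      by (intro sum.cong) (use j orth in auto)
    also have "\<dots> = v \<bullet> e j" using j by simp
    finally show ?thesis
      using j by (simp add: orthogonal_def inner_diff_left inner_sum_left)
  qed
  moreover have "(\<Sum>i<m. (v \<bullet> e i) *\<^sub>R e i) \<in> span (e ` {..<m})"
    by (intro span_sum span_scale span_base) auto
  then have "?w \<in> span (e ` {..<m})" by (rule span_diff[OF v])
  ultimately have "orthogonal ?w ?w" by (meson orthogonal_to_span)
  then show ?thesis by (simp add: orthogonal_def)
qed

lemma norm_le_sum_orthonormal_coordinates:
  fixes e :: "nat \<Rightarrow> 'h::real_inner"
  assumes orth: "\<And>i j. \<lbrakk>i < m; j < m\<rbrakk> \<Longrightarrow> e i \<bullet> e j = (if i = j then 1 else 0)"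
    and span: "span (e ` {..<m}) = UNIV"
  shows "norm v \<le> (\<Sum>i<m. \<bar>v \<bullet> e i\<bar>)"
proof -
  have "norm (e i) = 1" if "i < m" for i using orth[OF that that] by (simp add: norm_eq_1)
  moreover have "v = (\<Sum>i<m. (v \<bullet> e i) *\<^sub>R e i)"
    by (rule orthonormal_expansion[OF orth]) (auto simp: span)
  then have "norm v \<le> (\<Sum>i<m. norm ((v \<bullet> e i) *\<^sub>R e i))" by (metis norm_sum)
  ultimately show ?thesis by simp
qed

text \<open>This is the case distinction of the theorem. If no finite orthonormal family spans,
  Gram-Schmidt can always be continued.\<close>

lemma orthonormal_sequence_or_basis:
  obtains (sequence) e :: "nat \<Rightarrow> 'h::real_inner"
    where "\<And>i j. e i \<bullet> e j = (if i = j then 1 else 0)"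
  | (basis) m and e :: "nat \<Rightarrow> 'h::real_inner"
    where "\<And>i j. \<lbrakk>i < m; j < m\<rbrakk> \<Longrightarrow> e i \<bullet> e j = (if i = j then 1 else 0)" "span (e ` {..<m}) = UNIV"
proof (cases "\<exists>m. \<exists>e :: nat \<Rightarrow> 'h. (\<forall>i<m. \<forall>j<m. e i \<bullet> e j = (if i = j then 1 else 0)) \<and> span (e ` {..<m}) = UNIV")
  case True
  then show ?thesis using basis by blast
next
  case False
  have "\<exists>e :: nat \<Rightarrow> 'h. \<forall>n. norm (e n) = 1 \<and> (\<forall>i<n. e i \<bullet> e n = 0)"
  proof (rule dependent_wellorder_choice)
    fix n :: nat and f :: "nat \<Rightarrow> 'h"
    assume f: "\<And>k. k < n \<Longrightarrow> norm (f k) = 1 \<and> (\<forall>i<k. f i \<bullet> f k = 0)"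
    have orth: "f i \<bullet> f j = (if i = j then 1 else 0)" if "i < n" "j < n" for i j
      using f[OF that(1)] f[OF that(2)] by (cases i j rule: linorder_cases) (auto simp: norm_eq_1 inner_commute)
    then obtain x where x: "x \<notin> span (f ` {..<n})" using False by blast
    define w where "w = x - (\<Sum>i<n. (x \<bullet> f i) *\<^sub>R f i)"
    have "w \<noteq> 0"
    proof
      assume "w = 0"
      then have "x = (\<Sum>i<n. (x \<bullet> f i) *\<^sub>R f i)" by (simp add: w_def)
      moreover have "(\<Sum>i<n. (x \<bullet> f i) *\<^sub>R f i) \<in> span (f ` {..<n})"
        by (intro span_sum span_scale span_base) auto
      ultimately show False using x by simp
    qed
    moreover have "f j \<bullet> w = 0" if "j < n" for j
    proof -
      have "(\<Sum>i<n. (x \<bullet> f i) * (f j \<bullet> f i)) = (\<Sum>i<n. if i = j then x \<bullet> f j else 0)"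
        by (intro sum.cong) (use that orth in auto)
      then show ?thesis using that
        by (simp add: w_def inner_diff_right inner_sum_right inner_commute)
    qed
    ultimately show "\<exists>r. norm r = 1 \<and> (\<forall>i<n. f i \<bullet> r = 0)"
      by (intro exI[of _ "w /\<^sub>R norm w"]) simp
  qed auto
  then obtain e :: "nat \<Rightarrow> 'h" where e: "\<And>n. norm (e n) = 1" "\<And>i n. i < n \<Longrightarrow> e i \<bullet> e n = 0" by blast
  have "e i \<bullet> e j = (if i = j then 1 else 0)" for i j
    using e(1)[of i] e(2)[of i j] e(2)[of j i]
    by (cases i j rule: linorder_cases) (simp_all add: norm_eq_1 inner_commute[of "e i" "e j"])
  then show ?thesis by (rule sequence)
qed

section \<open>The dimension bound and the linear embedding\<close>

text \<open>\<open>hex_chain\<close> is applied to the rescaled coordinates of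
  \<open>\<sigma>\<close> on the grid with mesh \<open>h\<close> spanned by the \<open>m + 1\<close>
  vectors \<open>b i\<close>. The resulting chain is too long to stay within distance
  \<open>r\<close> of its start, but passing \<open>r\<close> would separate values of
  \<open>\<sigma>\<close> that are close.\<close>

lemma finite_dimensional_separation_contradiction:
  fixes \<sigma> :: "'x::real_normed_vector \<Rightarrow> 'h::real_inner" and b :: "nat \<Rightarrow> 'x"
  assumes uc: "uniformly_continuous_on UNIV \<sigma>"
    and pos: "0 < r" "0 < \<eta>" "0 < \<delta>"
    and sep: "\<And>x y. \<bar>norm (x - y) - r\<bar> < \<eta> \<Longrightarrow> \<delta> \<le> norm (\<sigma> x - \<sigma> y)"
    and orth: "\<And>i j. \<lbrakk>i < m; j < m\<rbrakk> \<Longrightarrow> e i \<bullet> e j = (if i = j then 1 else 0)"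
    and span: "span (e ` {..<m}) = (UNIV :: 'h set)"
    and indep: "\<And>c. (\<Sum>i<Suc m. c i *\<^sub>R b i) = 0 \<Longrightarrow> \<forall>i<Suc m. c i = 0"
  shows False
proof -
  obtain \<kappa> where \<kappa>: "0 < \<kappa>" "\<And>c i. i < Suc m \<Longrightarrow> \<kappa> * \<bar>c i\<bar> \<le> norm (\<Sum>i<Suc m. c i *\<^sub>R b i)"
    using coefficients_bounded_by_norm[OF indep] by blast
  \<comment> \<open>If all \<open>m\<close> coordinates are at most \<open>s\<close>, the norm is at
    most \<open>m * s\<close>, which is below \<open>\<delta>\<close>.\<close>
  define s where "s = \<delta> / (real m + 1)"
  have s: "0 < s" using pos by (simp add: s_def)
  have small: "norm v < \<delta>" if v: "\<And>k. k < m \<Longrightarrow> \<bar>v \<bullet> e k\<bar> \<le> s" for v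
  proof -
    have "norm v \<le> (\<Sum>i<m. \<bar>v \<bullet> e i\<bar>)" by (rule norm_le_sum_orthonormal_coordinates[OF orth span])
    also have "\<dots> \<le> (\<Sum>i<m. s)" using v by (intro sum_mono) auto
    also have "\<dots> < \<delta>" using pos by (simp add: s_def field_simps)
    finally show ?thesis .
  qed
  obtain \<theta> where \<theta>: "0 < \<theta>" "\<And>x y. norm (x - y) < \<theta> \<Longrightarrow> 
    norm (\<sigma> x - \<sigma> y) < s * (1 / (10 * real m + 10))"
    by (rule uniformly_continuous_normE[OF uc, of "s * (1 / (10 * real m + 10))"])
       (use s in \<open>auto intro!: mult_pos_pos divide_pos_pos add_nonneg_pos\<close>)
  define M where "M = 1 + (\<Sum>i<Suc m. norm (b i))"
  have M: "0 < M" "(\<Sum>i<Suc m. norm (b i)) < M"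
    unfolding M_def by (auto intro!: add_pos_nonneg sum_nonneg simp del: sum.lessThan_Suc)
  \<comment> \<open>Adjacent grid points come closer than \<open>\<theta>\<close>, so that
    \<open>F\<close> varies slowly, and closer than \<open>\<eta>\<close>, so that no step jumps
    over the separated distances around \<open>r\<close>.\<close>
  define h where "h = min \<theta> \<eta> / M"
  have h: "0 < h" "h * (\<Sum>i<Suc m. norm (b i)) < min \<theta> \<eta>"
  proof -
    show h0: "0 < h" using \<theta> pos M by (simp add: h_def)
    have "h * (\<Sum>i<Suc m. norm (b i)) < h * M" using M(2) h0 by (rule mult_strict_left_mono)
    then show "h * (\<Sum>i<Suc m. norm (b i)) < min \<theta> \<eta>" using M(1) by (simp add: h_def del: sum.lessThan_Suc)
  qed
  define X where "X z = (\<Sum>i<Suc m. (h * real (z i)) *\<^sub>R b i)" for z :: "nat \<Rightarrow> nat"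
  have X_diff: "X z - X w = (\<Sum>i<Suc m. (h * (real (z i) - real (w i))) *\<^sub>R b i)" for z w
    unfolding X_def sum_subtractf[symmetric] by (simp only: scaleR_diff_left[symmetric] right_diff_distrib)
  have X_adj: "norm (X z - X w) < min \<theta> \<eta>" if "adjacent m z w" for z w
  proof -
    have "norm (X z - X w) \<le> (\<Sum>i<Suc m. norm ((h * (real (z i) - real (w i))) *\<^sub>R b i))"
      unfolding X_diff by (rule norm_sum)
    also have "\<dots> \<le> (\<Sum>i<Suc m. h * norm (b i))"
    proof (rule sum_mono)
      fix i assume "i \<in> {..<Suc m}"
      then have "z i \<le> w i + 1" "w i \<le> z i + 1" using that by (auto simp: adjacent_def less_Suc_eq_le)
      then have "\<bar>real (z i) - real (w i)\<bar> \<le> 1" by linarith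
      then have "h * \<bar>real (z i) - real (w i)\<bar> \<le> h" using h(1) by (simp add: mult_left_le)
      then show "norm ((h * (real (z i) - real (w i))) *\<^sub>R b i) \<le> h * norm (b i)"
        using h(1) by (simp add: abs_mult mult_right_mono)
    qed
    also have "\<dots> < min \<theta> \<eta>" using h(2) by (simp add: sum_distrib_left del: sum.lessThan_Suc)
    finally show ?thesis .
  qed
  define F where "F z k = (\<sigma> (X z) \<bullet> e k) / s" for z k
  have F_diff: "\<bar>F z k - F w k\<bar> = \<bar>(\<sigma> (X z) - \<sigma> (X w)) \<bullet> e k\<bar> / s" for z w k
    using s by (simp add: F_def inner_diff_left diff_divide_distrib[symmetric] abs_divide)
  \<comment> \<open>By the choice of \<open>\<kappa>\<close>, points on opposite faces are then at
    distance at least \<open>r\<close>.\<close>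
  define p where "p = nat \<lceil>r / (\<kappa> * h)\<rceil> + 1"
  have p: "0 < p" "r \<le> \<kappa> * (h * real p)"
  proof -
    show "0 < p" by (simp add: p_def)
    have "r / (\<kappa> * h) \<le> real p" unfolding p_def by linarith
    then show "r \<le> \<kappa> * (h * real p)" using \<kappa>(1) h(1) by (simp add: divide_le_eq mult_ac)
  qed
  have F_adj: "\<bar>F z k - F w k\<bar> \<le> 1 / (10 * real m + 10)" if "adjacent m z w" "k < m" for z w k
  proof -
    have "norm (e k) = 1" using orth[OF that(2) that(2)] by (simp add: norm_eq_1)
    then have "\<bar>(\<sigma> (X z) - \<sigma> (X w)) \<bullet> e k\<bar> \<le> norm (\<sigma> (X z) - \<sigma> (X w))"
      using Cauchy_Schwarz_ineq2[of "\<sigma> (X z) - \<sigma> (X w)" "e k"] by simp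
    also have "\<dots> \<le> s * (1 / (10 * real m + 10))" using \<theta>(2) X_adj[OF that(1)] by (simp add: less_imp_le)
    finally show ?thesis unfolding F_diff using s by (simp add: divide_le_eq mult_ac)
  qed
  obtain i a c where i: "i \<le> m" "a i = 0" "c i = p"
    and ch: "(\<lambda>z w. in_grid m p w \<and> adjacent m z w \<and> (\<forall>k<m. \<bar>F w k - F a k\<bar> \<le> 1))\<^sup>*\<^sup>* a c"
    by (rule hex_chain[OF p(1), of m F]) (use F_adj in blast)+
  \<comment> \<open>A discrete intermediate value argument: the distance to \<open>X a\<close>
    starts at 0, changes by less than \<open>\<eta>\<close>, and never enters the band of width
    \<open>\<eta>\<close> around \<open>r\<close>, where \<open>\<sigma>\<close> would differ by at
    least \<open>\<delta>\<close>.\<close>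
  have "norm (X c - X a) < r" using ch
  proof induction
    case base then show ?case using pos by simp
  next
    case (step z w)
    have "norm (\<sigma> (X w) - \<sigma> (X a)) < \<delta>"
    proof (rule small)
      fix k assume "k < m"
      then have "\<bar>(\<sigma> (X w) - \<sigma> (X a)) \<bullet> e k\<bar> / s \<le> 1" using step.hyps unfolding F_diff[symmetric] by blast
      then show "\<bar>(\<sigma> (X w) - \<sigma> (X a)) \<bullet> e k\<bar> \<le> s" using s by simp
    qed
    then have "\<not> \<bar>norm (X w - X a) - r\<bar> < \<eta>" using sep by (meson not_le)
    moreover have "norm (X w - X a) \<le> norm (X z - X w) + norm (X z - X a)"
      using norm_triangle_ineq[of "X w - X z" "X z - X a"] by (simp add: norm_minus_commute)
    moreover have "norm (X z - X w) < \<eta>" using X_adj[of z w] step.hyps by simp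
    ultimately show ?case using step.IH by linarith
  qed
  moreover have "\<kappa> * \<bar>h * (real (c i) - real (a i))\<bar> \<le> norm (X c - X a)"
    unfolding X_diff using i by (intro \<kappa>(2)) auto
  ultimately show False using i p h(1) by (simp add: abs_mult)
qed

text \<open>Basis vectors are sent to multiples of orthonormal vectors. Inner products with the
  latter recover the coordinates, which gives the lower bound.\<close>

lemma finite_dimensional_ball_embeds:
  fixes B :: "'x::real_normed_vector set" and e :: "nat \<Rightarrow> 'h::real_inner"
  assumes B: "independent B" "span B = UNIV" "finite B" "card B \<le> m"
    and orth: "\<And>i j. \<lbrakk>i < m; j < m\<rbrakk> \<Longrightarrow> e i \<bullet> e j = (if i = j then 1 else 0)"
  shows "uniformly_embeds (cball (0::'x) 1) (cball (0::'h) 1)"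
proof -
  define n where "n = card B"
  obtain b where b: "bij_betw b {..<n} B"
    using ex_bij_betw_nat_finite[OF B(3)] unfolding n_def atLeast0LessThan by blast
  define C where "C x i = representation B x (b i)" for x i
  have C_sum: "(\<Sum>i<n. C x i *\<^sub>R b i) = x" for x
    using sum.reindex_bij_betw[OF b, of "\<lambda>v. representation B x v *\<^sub>R v"]
      sum_representation_eq[of B x B] B by (simp add: C_def)
  have C_diff: "C (x - y) i = C x i - C y i" for x y i
    using B by (simp add: C_def representation_diff)
  have indep: "\<forall>i<n. c i = 0" if "(\<Sum>i<n. c i *\<^sub>R b i) = 0" for c
    by (rule independent_indexed[OF B(1,3) b that])
  obtain \<kappa> where \<kappa>: "0 < \<kappa>" "\<And>c i. i < n \<Longrightarrow> \<kappa> * \<bar>c i\<bar> \<le> norm (\<Sum>i<n. c i *\<^sub>R b i)"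
    using coefficients_bounded_by_norm[OF indep] by blast
  \<comment> \<open>The factor makes \<open>\<phi>\<close> a contraction: each of the
    \<open>n\<close> coordinates is at most \<open>norm x / \<kappa>\<close>.\<close>
  define a where "a = \<kappa> / (real n + 1)"
  have a: "0 < a" using \<kappa>(1) by (simp add: a_def)
  define \<phi> where "\<phi> x = a *\<^sub>R (\<Sum>i<n. C x i *\<^sub>R e i)" for x
  have \<phi>_diff: "\<phi> x - \<phi> y = \<phi> (x - y)" for x y
    by (simp add: \<phi>_def C_diff scaleR_diff_left sum_subtractf scaleR_diff_right)
  have norm_e: "norm (e i) = 1" if "i < n" for i
    using orth[of i i] that B(4) by (simp add: n_def norm_eq_1)
  have upper: "norm (\<phi> x) \<le> norm x" for x
  proof -
    have "norm (\<Sum>i<n. C x i *\<^sub>R e i) \<le> (\<Sum>i<n. norm (C x i *\<^sub>R e i))" by (rule norm_sum)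
    also have "\<dots> \<le> (\<Sum>i<n. norm x / \<kappa>)"
      using \<kappa>(2)[of _ "C x"] \<kappa>(1) norm_e by (intro sum_mono) (simp add: C_sum field_simps)
    finally have "norm (\<phi> x) \<le> a * (real n * (norm x / \<kappa>))"
      using a by (simp add: \<phi>_def mult_left_mono del: times_divide_eq_right)
    also have "\<dots> = real n / (real n + 1) * norm x" using \<kappa>(1) by (simp add: a_def)
    also have "\<dots> \<le> 1 * norm x" by (intro mult_right_mono) auto
    finally show ?thesis by simp
  qed
  define M where "M = 1 + (\<Sum>i<n. norm (b i))"
  have M: "0 < M" unfolding M_def by (intro add_pos_nonneg sum_nonneg) auto
  have lower: "a / M * norm x \<le> norm (\<phi> x)" for x
  proof -
    have coord: "a * \<bar>C x i\<bar> \<le> norm (\<phi> x)" if "i < n" for i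
    proof -
      have "(\<Sum>j<n. C x j * (e j \<bullet> e i)) = (\<Sum>j<n. if j = i then C x i else 0)"
        using B(4) that orth by (intro sum.cong) (auto simp: n_def)
      then have "\<phi> x \<bullet> e i = a * C x i" using that by (simp add: \<phi>_def inner_sum_left)
      then show ?thesis using Cauchy_Schwarz_ineq2[of "\<phi> x" "e i"] norm_e[OF that] a by (simp add: abs_mult)
    qed
    have "a * norm x = a * norm (\<Sum>i<n. C x i *\<^sub>R b i)" by (simp add: C_sum)
    also have "\<dots> \<le> a * (\<Sum>i<n. norm (C x i *\<^sub>R b i))" using a by (intro mult_left_mono norm_sum) auto
    also have "\<dots> = (\<Sum>i<n. a * \<bar>C x i\<bar> * norm (b i))" by (simp add: sum_distrib_left mult_ac)
    also have "\<dots> \<le> (\<Sum>i<n. norm (\<phi> x) * norm (b i))" using coord by (intro sum_mono mult_right_mono) auto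
    also have "\<dots> \<le> norm (\<phi> x) * M" by (simp add: M_def sum_distrib_left[symmetric] mult_left_mono)
    finally show ?thesis using M by (simp add: field_simps)
  qed
  show ?thesis
  proof (rule uniformly_embedsI)
    show "\<phi> \<in> cball 0 1 \<rightarrow> cball 0 1" using upper order_trans by fastforce
    show "uniformly_continuous_on (cball 0 1) \<phi>"
      unfolding uniformly_continuous_on_def dist_norm \<phi>_diff using upper le_less_trans by blast
    show "0 < a / M" using a M by simp
    show "a / M * dist x y \<le> dist (\<phi> x) (\<phi> y)" for x y
      using lower[of "x - y"] by (simp add: dist_norm \<phi>_diff)
  qed
qed

subsection \<open>Invariant means\<close>

text \<open>
  Averages over the boxes \<open>{a\<^sub>0 d\<^sub>0 + \<dots> + a\<^sub>k\<^sub>-\<^sub>1 d\<^sub>k\<^sub>-\<^sub>1 | 0 \<le> a\<^sub>i < N}\<close>, which form a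
  Folner sequence for the group generated by the sequence \<open>d\<close> when \<open>k = N \<rightarrow> \<infinity>\<close>.
\<close>

primrec lattice_average :: "(nat \<Rightarrow> 'x::real_vector) \<Rightarrow> nat \<Rightarrow> nat \<Rightarrow> ('x \<Rightarrow> real) \<Rightarrow> 'x \<Rightarrow> real" where
  "lattice_average d N 0 F = F"
| "lattice_average d N (Suc k) F =
     (\<lambda>z. (\<Sum>t<N. lattice_average d N k F (z + real t *\<^sub>R d k)) / real N)"

lemma lattice_average_translate:
  "lattice_average d N k (\<lambda>z. F (z + g)) z = lattice_average d N k F (z + g)"
  by (induction k arbitrary: z) (simp_all add: add_ac)

lemma lattice_average_sum:
  "lattice_average d N k (\<lambda>z. \<Sum>i\<in>I. c i * F i z) z = (\<Sum>i\<in>I. c i * lattice_average d N k (F i) z)"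
proof (induction k arbitrary: z)
  case (Suc k)
  have "(\<Sum>t<N. \<Sum>i\<in>I. c i * lattice_average d N k (F i) (z + real t *\<^sub>R d k)) =
    (\<Sum>i\<in>I. \<Sum>t<N. c i * lattice_average d N k (F i) (z + real t *\<^sub>R d k))"
    by (rule sum.swap)
  then have "(\<Sum>t<N. \<Sum>i\<in>I. c i * lattice_average d N k (F i) (z + real t *\<^sub>R d k)) / real N =
      (\<Sum>i\<in>I. c i * ((\<Sum>t<N. lattice_average d N k (F i) (z + real t *\<^sub>R d k)) / real N))"
    by (simp only: sum_distrib_left sum_divide_distrib times_divide_eq_right)
  then show ?case by (simp add: Suc)
qed simp

lemma lattice_average_ge:
  assumes "\<And>z. lo \<le> F z" "0 < N"
  shows "lo \<le> lattice_average d N k F z"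
proof (induction k arbitrary: z)
  case (Suc k)
  have "(\<Sum>t<N. lo) \<le> (\<Sum>t<N. lattice_average d N k F (z + real t *\<^sub>R d k))"
    by (intro sum_mono Suc)
  then show ?case using assms(2) by (simp add: field_simps)
qed (use assms in simp)

lemma lattice_average_le:
  assumes "\<And>z. F z \<le> hi" "0 < N"
  shows "lattice_average d N k F z \<le> hi"
proof (induction k arbitrary: z)
  case (Suc k)
  have "(\<Sum>t<N. lattice_average d N k F (z + real t *\<^sub>R d k)) \<le> (\<Sum>t<N. hi)"
    by (intro sum_mono Suc)
  then show ?case using assms(2) by (simp add: field_simps)
qed (use assms in simp)

text \<open>In direction \<open>j\<close> the difference telescopes to two boundary terms of size at
  most \<open>M\<close>, divided by \<open>N\<close>. Averaging in the other directions preserves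
  the bound.\<close>

lemma lattice_average_shift:
  assumes F: "\<And>z. \<bar>F z\<bar> \<le> M" and N: "0 < N" and j: "j < k"
  shows "\<bar>lattice_average d N k (\<lambda>z. F (z + d j)) z - lattice_average d N k F z\<bar> \<le> 2 * M / real N"
  using j
proof (induction k arbitrary: z)
  case (Suc k)
  let ?A = "lattice_average d N k F"
  let ?\<Delta> = "\<lambda>z. lattice_average d N k (\<lambda>z. F (z + d j)) z - ?A z"
  have split: "lattice_average d N (Suc k) (\<lambda>z. F (z + d j)) z - lattice_average d N (Suc k) F z =
    (\<Sum>t<N. ?\<Delta> (z + real t *\<^sub>R d k)) / real N"
    by (simp add: sum_subtractf diff_divide_distrib)
  show ?case
  proof (cases "j = k")
    case True
    have "?\<Delta> (z + real t *\<^sub>R d k) = ?A (z + real (Suc t) *\<^sub>R d k) - ?A (z + real t *\<^sub>R d k)" for t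
      using True by (simp add: lattice_average_translate scaleR_left_distrib add_ac)
    then have "(\<Sum>t<N. ?\<Delta> (z + real t *\<^sub>R d k)) = ?A (z + real N *\<^sub>R d k) - ?A z"
      using sum_lessThan_telescope[of "\<lambda>t. ?A (z + real t *\<^sub>R d k)" N] by simp
    moreover have "\<bar>?A w\<bar> \<le> M" for w
      using lattice_average_ge[of "- M" F N d k w] lattice_average_le[of F M N d k w] F N
      by (simp add: abs_le_iff minus_le_iff)
    then have "\<bar>?A (z + real N *\<^sub>R d k)\<bar> \<le> M" "\<bar>?A z\<bar> \<le> M" by blast+
    then have "\<bar>?A (z + real N *\<^sub>R d k) - ?A z\<bar> \<le> 2 * M" by linarith
    ultimately show ?thesis unfolding split by (simp add: abs_divide divide_right_mono)
  next
    case False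
    then have "\<bar>?\<Delta> w\<bar> \<le> 2 * M / real N" for w using Suc by simp
    then have "\<bar>\<Sum>t<N. ?\<Delta> (z + real t *\<^sub>R d k)\<bar> \<le> (\<Sum>t<N. 2 * M / real N)"
      by (intro order_trans[OF sum_abs] sum_mono)
    also have "\<dots> = 2 * M" using N by simp
    finally show ?thesis unfolding split by (simp add: abs_divide divide_right_mono)
  qed
qed simp

text \<open>For countably many functions a diagonal subsequence of the averages suffices as a mean.
  The first property combines linearity, positivity and normalisation in the single form used
  later.\<close>

lemma countable_invariant_mean:
  fixes d :: "nat \<Rightarrow> 'x::real_vector" and f :: "'i \<Rightarrow> 'x \<Rightarrow> real"
  assumes "countable I" and bdd: "\<And>i. i \<in> I \<Longrightarrow> \<exists>B. \<forall>z. \<bar>f i z\<bar> \<le> B"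
  obtains \<mu> where
    "\<And>(K :: 'k set) c s lo. \<lbrakk>s ` K \<subseteq> I; \<And>z. lo \<le> (\<Sum>k\<in>K. c k * f (s k) z)\<rbrakk>
      \<Longrightarrow> lo \<le> (\<Sum>k\<in>K. c k * \<mu> (s k))"
    "\<And>i j n. \<lbrakk>i \<in> I; j \<in> I; \<And>z. f j z = f i (z + d n)\<rbrakk> \<Longrightarrow> \<mu> j = \<mu> i"
proof -
  have "\<exists>B>0. \<forall>z. \<bar>f i z\<bar> \<le> B" if "i \<in> I" for i
    using bdd[OF that] by (metis abs_ge_zero order_trans le_less_trans less_add_one less_imp_le)
  then obtain B where B: "\<And>i. i \<in> I \<Longrightarrow> 0 < B i" "\<And>i z. i \<in> I \<Longrightarrow> \<bar>f i z\<bar> \<le> B i" by metis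
  \<comment> \<open>Side length and number of directions grow together, so every \<open>d n\<close>
    is eventually among the directions and the shift error tends to 0.\<close>
  define A where "A N i = lattice_average d (Suc N) (Suc N) (f i) 0" for N i
  have "\<bar>A N i\<bar> \<le> B i" if "i \<in> I" for N i
    using lattice_average_ge[of "- B i" "f i" "Suc N"] lattice_average_le[of "f i" "B i" "Suc N"]
      B(2)[OF that] unfolding A_def by (simp add: abs_le_iff minus_le_iff del: lattice_average.simps)
  \<comment> \<open>Dividing by \<open>B i\<close> gives the bound 1, common to all indices, that
    the subsequence lemma asks for.\<close>
  then have "norm (A N i / B i) \<le> 1" if "i \<in> I" for N i
    using that B(1)[OF that] by (simp add: divide_le_eq)
  then obtain k where k: "strict_mono (k :: nat \<Rightarrow> nat)"
    "\<And>i. i \<in> I \<Longrightarrow> \<exists>l. (\<lambda>N. A (k N) i / B i) \<longlonglongrightarrow> l"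
    using function_convergent_subsequence[OF \<open>countable I\<close>, of "\<lambda>N i. A N i / B i" 1] by blast
  have "\<exists>l. (\<lambda>N. A (k N) i) \<longlonglongrightarrow> l" if i: "i \<in> I" for i
  proof -
    obtain l where "(\<lambda>N. A (k N) i / B i) \<longlonglongrightarrow> l" using k(2)[OF i] by blast
    then have "(\<lambda>N. A (k N) i / B i * B i) \<longlonglongrightarrow> l * B i" by (intro tendsto_mult tendsto_const)
    then show ?thesis using B(1)[OF i] by auto
  qed
  then obtain \<mu> where \<mu>: "\<And>i. i \<in> I \<Longrightarrow> (\<lambda>N. A (k N) i) \<longlonglongrightarrow> \<mu> i" by metis
  show thesis
  proof (rule that)
    fix K :: "'k set" and c s lo
    assume s: "s ` K \<subseteq> I" and lo: "\<And>z. lo \<le> (\<Sum>k\<in>K. c k * f (s k) z)"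
    have "(\<lambda>N. \<Sum>i\<in>K. c i * A (k N) (s i)) \<longlonglongrightarrow> (\<Sum>i\<in>K. c i * \<mu> (s i))"
      using s by (intro tendsto_sum tendsto_mult tendsto_const \<mu>) auto
    moreover have "lo \<le> (\<Sum>i\<in>K. c i * A N (s i))" for N
      unfolding A_def lattice_average_sum[symmetric] by (rule lattice_average_ge[OF lo]) simp
    ultimately show "lo \<le> (\<Sum>k\<in>K. c k * \<mu> (s k))" by (intro LIMSEQ_le_const) auto
  next
    fix i j n assume i: "i \<in> I" and j: "j \<in> I" and f: "\<And>z. f j z = f i (z + d n)"
    have "f j = (\<lambda>z. f i (z + d n))" using f by blast
    then have A: "\<bar>A N j - A N i\<bar> \<le> 2 * B i / real (Suc N)" if "n \<le> N" for N
      unfolding A_def using lattice_average_shift[of "f i" "B i" "Suc N" n "Suc N" d 0] B(2)[OF i] that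
      by (simp del: lattice_average.simps)
    have "(\<lambda>N. A (k N) j - A (k N) i) \<longlonglongrightarrow> 0"
    proof (rule Lim_null_comparison)
      show "\<forall>\<^sub>F N in sequentially. norm (A (k N) j - A (k N) i) \<le> 2 * B i * inverse (real (Suc N))"
        unfolding eventually_sequentially
      proof (intro exI[of _ n] allI impI)
        fix N assume "n \<le> N"
        then have "n \<le> k N" "N \<le> k N" using seq_suble[OF k(1), of N] by auto
        then have "\<bar>A (k N) j - A (k N) i\<bar> \<le> 2 * B i / real (Suc (k N))" using A by blast
        also have "\<dots> \<le> 2 * B i / real (Suc N)"
          using \<open>N \<le> k N\<close> B(1)[OF i] by (intro divide_left_mono) auto
        finally show "norm (A (k N) j - A (k N) i) \<le> 2 * B i * inverse (real (Suc N))"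
          by (simp add: divide_inverse)
      qed
      show "(\<lambda>N. 2 * B i * inverse (real (Suc N))) \<longlonglongrightarrow> 0"
        using tendsto_mult[OF tendsto_const LIMSEQ_inverse_real_of_nat] by force
    qed
    moreover have "(\<lambda>N. A (k N) j - A (k N) i) \<longlonglongrightarrow> \<mu> j - \<mu> i" by (intro tendsto_diff \<mu> i j)
    ultimately show "\<mu> j = \<mu> i" using LIMSEQ_unique by fastforce
  qed
qed

subsection \<open>Gram representation of positive semidefinite kernels\<close>

definition pos_semidef :: "(nat \<Rightarrow> nat \<Rightarrow> real) \<Rightarrow> bool" where
  "pos_semidef K \<longleftrightarrow> (\<forall>i j. K i j = K j i) \<and> (\<forall>n c. 0 \<le> (\<Sum>i<n. \<Sum>j<n. c i * c j * K i j))"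

text \<open>The quadratic form is evaluated at \<open>c\<close>, padded by zeros, plus
  \<open>t\<close> times the unit vector of index \<open>k\<close>; \<open>k\<close> may lie inside
  or outside the range of \<open>c\<close>.\<close>

lemma pos_semidef_perturb:
  assumes K: "pos_semidef K"
  shows "0 \<le> (\<Sum>i<n. \<Sum>j<n. c i * c j * K i j) + 2 * t * (\<Sum>i<n. c i * K i k) + t\<^sup>2 * K k k"
proof -
  define N where "N = max n (Suc k)"
  define a where "a i = (if i < n then c i else 0)" for i
  define b where "b i = (if i = k then t else 0)" for i
  have sub: "{..<n} \<subseteq> {..<N}" and k: "k < N" by (auto simp: N_def)
  have a_sum: "(\<Sum>i<N. a i * g i) = (\<Sum>i<n. c i * g i)" for g
    by (rule sum.mono_neutral_cong_right) (use sub in \<open>auto simp: a_def\<close>)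
  have b_sum: "(\<Sum>i<N. b i * g i) = t * g k" for g
  proof -
    have "(\<Sum>i<N. b i * g i) = (\<Sum>i<N. if i = k then t * g k else 0)"
      by (intro sum.cong) (auto simp: b_def)
    then show ?thesis using k by simp
  qed
  have bilin: "(\<Sum>i<N. \<Sum>j<N. x i * y j * K i j) = (\<Sum>i<N. x i * (\<Sum>j<N. y j * K i j))" for x y
    by (simp add: sum_distrib_left mult_ac)
  have "0 \<le> (\<Sum>i<N. \<Sum>j<N. (a i + b i) * (a j + b j) * K i j)"
    by (rule conjunct2[OF K[unfolded pos_semidef_def], THEN spec[where x = N],
          THEN spec[where x = "\<lambda>i. a i + b i"]])
  also have "\<dots> = (\<Sum>i<N. \<Sum>j<N. a i * a j * K i j) + (\<Sum>i<N. \<Sum>j<N. a i * b j * K i j)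
      + (\<Sum>i<N. \<Sum>j<N. b i * a j * K i j) + (\<Sum>i<N. \<Sum>j<N. b i * b j * K i j)"
    by (simp add: distrib_left distrib_right sum.distrib)
  also have "\<dots> = (\<Sum>i<n. c i * (\<Sum>j<n. c j * K i j)) + (\<Sum>i<n. c i * (t * K i k))
      + t * (\<Sum>j<n. c j * K k j) + t * (t * K k k)"
    unfolding bilin a_sum b_sum ..
  also have "(\<Sum>j<n. c j * K k j) = (\<Sum>j<n. c j * K j k)"
    using K by (simp add: pos_semidef_def)
  finally show ?thesis
    by (simp add: sum_distrib_left power2_eq_square mult_ac)
qed

lemma pos_semidef_diag_nonneg:
  assumes "pos_semidef K"
  shows "0 \<le> K k k"
  using pos_semidef_perturb[OF assms, where n = 0 and t = 1 and k = k] by simp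

text \<open>If the diagonal entry vanishes, the perturbed form is affine in \<open>t\<close>, and a
  nonzero slope would make it negative.\<close>

lemma pos_semidef_diag_zero:
  assumes K: "pos_semidef K" and "K k k = 0"
  shows "K i k = 0"
proof (rule ccontr)
  assume nz: "K i k \<noteq> 0"
  have delta: "(\<Sum>j<Suc i. (if j = i then 1 else 0) * g j) = g i" for g :: "nat \<Rightarrow> real"
    by (simp add: sum.neutral)
  \<comment> \<open>At this \<open>t\<close> the form takes the value -1.\<close>
  define t where "t = - (K i i + 1) / (2 * K i k)"
  have "0 \<le> (\<Sum>j<Suc i. (if j = i then 1 else 0) * (\<Sum>l<Suc i. (if l = i then 1 else 0) * K j l))
      + 2 * t * K i k"
    using pos_semidef_perturb[OF K, where n = "Suc i" and c = "\<lambda>j. if j = i then 1 else 0"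
        and t = t and k = k] assms(2)
    unfolding delta by (simp add: sum_distrib_left mult_ac)
  then have "0 \<le> K i i + 2 * t * K i k" unfolding delta .
  moreover have "2 * t * K i k = - (K i i + 1)" using nz by (simp add: t_def)
  ultimately show False by simp
qed

text \<open>The index set is not shrunk: for a positive semidefinite \<open>K\<close>, row and
  column \<open>k\<close> become zero instead.\<close>

definition schur_complement :: "nat \<Rightarrow> (nat \<Rightarrow> nat \<Rightarrow> real) \<Rightarrow> nat \<Rightarrow> nat \<Rightarrow> real" where
  "schur_complement k K i j = K i j - K i k * K j k / K k k"

text \<open>For a nonzero pivot its form at \<open>c\<close> is the minimum over \<open>t\<close> of
  the expression in \<open>pos_semidef_perturb\<close>, attained at
  \<open>- ?S / K k k\<close>.\<close>

lemma pos_semidef_schur_complement: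
  assumes K: "pos_semidef K"
  shows "pos_semidef (schur_complement k K)"
  unfolding pos_semidef_def schur_complement_def
proof (intro conjI allI)
  show "K i j - K i k * K j k / K k k = K j i - K j k * K i k / K k k" for i j
    using K by (simp add: pos_semidef_def mult.commute)
  fix n :: nat and c :: "nat \<Rightarrow> real"
  let ?S = "\<Sum>i<n. c i * K i k"
  have "(\<Sum>i<n. \<Sum>j<n. c i * c j * (K i j - K i k * K j k / K k k)) =
      (\<Sum>i<n. \<Sum>j<n. c i * c j * K i j) - ?S * ?S / K k k"
    unfolding sum_product sum_divide_distrib by (simp add: algebra_simps sum_subtractf)
  also have "\<dots> \<ge> 0"
  proof (cases "K k k = 0")
    case True
    then show ?thesis using K by (simp add: pos_semidef_def)
  next
    case False
    have "2 * (- ?S / K k k) * ?S + (- ?S / K k k)\<^sup>2 * K k k = - (?S * ?S / K k k)"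
      using False by (simp add: field_simps power2_eq_square)
    then show ?thesis
      using pos_semidef_perturb[OF K, where n = n and c = c and t = "- ?S / K k k" and k = k]
      by linarith
  qed
  finally show "0 \<le> (\<Sum>i<n. \<Sum>j<n. c i * c j * (K i j - K i k * K j k / K k k))" .
qed

text \<open>
  Cholesky decomposition by repeated Schur complements. Vanishing pivots need no special treatment,
  because division by zero yields zero.
\<close>

primrec schur :: "(nat \<Rightarrow> nat \<Rightarrow> real) \<Rightarrow> nat \<Rightarrow> nat \<Rightarrow> nat \<Rightarrow> real" where
  "schur K 0 = K"
| "schur K (Suc k) = schur_complement k (schur K k)"

lemma pos_semidef_schur: "pos_semidef K \<Longrightarrow> pos_semidef (schur K k)"
  by (induction k) (auto intro: pos_semidef_schur_complement)

text \<open>Zero rows stay zero under later eliminations. Row \<open>k\<close> is cancelled by its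
  pivot, or is already zero if the pivot is.\<close>

lemma schur_eliminated:
  assumes "pos_semidef K" "i < k"
  shows "schur K k i j = 0"
  using assms(2)
proof (induction k arbitrary: j)
  case (Suc k)
  note psd = pos_semidef_schur[OF assms(1), of k]
  show ?case
  proof (cases "i = k")
    case True
    have "schur K k k j = schur K k j k" using psd by (simp add: pos_semidef_def)
    then show ?thesis using True pos_semidef_diag_zero[OF psd, of k j]
      by (cases "schur K k k k = 0") (auto simp: schur_complement_def)
  next
    case False
    then show ?thesis using Suc by (simp add: schur_complement_def)
  qed
qed simp

text \<open>The Cholesky factor \<open>L\<close> is lower triangular, so its rows are coefficients
  of finite combinations of the \<open>e k\<close>.\<close>

lemma pos_semidef_gram:
  fixes e :: "nat \<Rightarrow> 'h::real_inner"
  assumes K: "pos_semidef K" and orth: "\<And>i j. e i \<bullet> e j = (if i = j then 1 else 0)"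
  obtains v :: "nat \<Rightarrow> 'h" where "\<And>i j. v i \<bullet> v j = K i j"
proof -
  define L where "L i k = schur K k i k / sqrt (schur K k k k)" for i k
  have L: "schur K (Suc k) i j = schur K k i j - L i k * L j k" for i j k
    using pos_semidef_diag_nonneg[OF pos_semidef_schur[OF K, of k], of k]
    by (simp add: L_def schur_complement_def)
  have decomp: "K i j = (\<Sum>k<n. L i k * L j k) + schur K n i j" for i j n
    by (induction n) (simp_all add: L del: schur.simps(2))
  have L0: "L i k = 0" if "i < k" for i k
    using schur_eliminated[OF K that] by (simp add: L_def)
  define v where "v i = (\<Sum>k\<le>i. L i k *\<^sub>R e k)" for i
  have "v i \<bullet> v j = K i j" for i j
  proof -
    \<comment> \<open>After this many eliminations the remainder at \<open>(i, j)\<close> is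
      zero.\<close>
    define n where "n = Suc (max i j)"
    have v_eq: "v l = (\<Sum>k<n. L l k *\<^sub>R e k)" if "l < n" for l
      unfolding v_def by (rule sum.mono_neutral_left) (use that L0 in auto)
    have "i < n" "j < n" by (auto simp: n_def)
    then have "v i \<bullet> v j = (\<Sum>k<n. L i k *\<^sub>R e k) \<bullet> (\<Sum>l<n. L j l *\<^sub>R e l)"
      using v_eq by metis
    also have "\<dots> = (\<Sum>k<n. \<Sum>l<n. L i k * (L j l * (e k \<bullet> e l)))"
      by (simp only: inner_sum_left inner_scaleR_left)
         (simp only: inner_sum_right inner_scaleR_right sum_distrib_left)
    also have "\<dots> = (\<Sum>k<n. \<Sum>l<n. if l = k then L i k * L j k else 0)"
      by (intro sum.cong refl) (auto simp: orth)
    also have "\<dots> = (\<Sum>k<n. L i k * L j k)" by simp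
    also have "\<dots> = K i j"
      using decomp[of i j n] schur_eliminated[OF K, of i n j] by (simp add: n_def del: schur.simps(2))
    finally show ?thesis .
  qed
  then show thesis by (rule that)
qed

subsection \<open>Translation-invariant kernels and the theorem\<close>

text \<open>The subgroup generated by a countable dense set consists of the sums of lists over the
  set and its negatives, and there are only countably many such lists.\<close>

lemma countable_dense_subgroup:
  assumes "separable_space (euclidean :: 'x::real_normed_vector topology)"
  obtains G :: "'x::real_normed_vector set" where "countable G" "closure G = UNIV" "0 \<in> G"
    "\<And>x y. \<lbrakk>x \<in> G; y \<in> G\<rbrakk> \<Longrightarrow> x + y \<in> G" "\<And>x. x \<in> G \<Longrightarrow> - x \<in> G"
proof -
  obtain D :: "'x set" where D: "countable D" "closure D = UNIV"
    using assms by (auto simp: separable_space_def)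
  define L where "L = lists (D \<union> uminus ` D)"
  show thesis
  proof (rule that)
    show "countable (sum_list ` L)" unfolding L_def using D(1) by (intro countable_image countable_lists) auto
    have "x \<in> sum_list ` L" if "x \<in> D" for x
      using that by (intro image_eqI[of _ _ "[x]"]) (auto simp: L_def)
    then have "closure D \<subseteq> closure (sum_list ` L)" by (intro closure_mono) auto
    then show "closure (sum_list ` L) = UNIV" using D(2) by auto
    show "0 \<in> sum_list ` L" by (intro image_eqI[of _ _ "[]"]) (auto simp: L_def)
  next
    fix x y assume "x \<in> sum_list ` L" "y \<in> sum_list ` L"
    then obtain l l' where "l \<in> L" "l' \<in> L" "x = sum_list l" "y = sum_list l'" by blast
    then show "x + y \<in> sum_list ` L" by (intro image_eqI[of _ _ "l @ l'"]) (auto simp: L_def)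
  next
    fix x assume "x \<in> sum_list ` L"
    then obtain l where "l \<in> L" "x = sum_list l" by blast
    moreover have "- sum_list l = sum_list (map uminus l)" by (induction l) simp_all
    moreover have "map uminus l \<in> L" using \<open>l \<in> L\<close> by (force simp: L_def)
    ultimately show "- x \<in> sum_list ` L" by (intro image_eqI[of _ _ "map uminus l"]) simp_all
  qed
qed

text \<open>The segment from \<open>y + z\<close> to \<open>x + z\<close> is cut into
  \<open>n\<close> short steps, each moving \<open>\<sigma>\<close> by less than 1, with
  \<open>n\<close> independent of \<open>z\<close>. This makes the displacements bounded functions
  of \<open>z\<close>, to which a mean applies.\<close>

lemma uniformly_continuous_bounded_displacement:
  fixes \<sigma> :: "'x::real_normed_vector \<Rightarrow> 'h::real_normed_vector"
  assumes "uniformly_continuous_on UNIV \<sigma>"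
  shows "\<exists>B. \<forall>z. norm (\<sigma> (x + z) - \<sigma> (y + z)) \<le> B"
proof -
  obtain \<theta> where \<theta>: "0 < \<theta>" "\<And>x y. norm (x - y) < \<theta> \<Longrightarrow> norm (\<sigma> x - \<sigma> y) < 1"
    by (rule uniformly_continuous_normE[OF assms zero_less_one]) (rule that)
  obtain n where n: "norm (x - y) / \<theta> < real n" using reals_Archimedean2 by blast
  then have n0: "0 < real n" using divide_nonneg_pos[OF norm_ge_zero \<theta>(1)] by (rule le_less_trans[rotated])
  define u where "u = (1 / real n) *\<^sub>R (x - y)"
  have norm_u: "norm u = norm (x - y) / real n" by (simp add: u_def)
  have u: "norm u < \<theta>" unfolding norm_u using n n0 \<theta>(1) by (simp add: field_simps)
  have step: "norm (\<sigma> (y + z + real k *\<^sub>R u) - \<sigma> (y + z)) \<le> real k" for z k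
  proof (induction k)
    case (Suc k)
    have "norm (\<sigma> (y + z + real (Suc k) *\<^sub>R u) - \<sigma> (y + z + real k *\<^sub>R u)) < 1"
      by (rule \<theta>(2)) (use u in \<open>simp add: scaleR_left_distrib\<close>)
    then show ?case using Suc
      norm_triangle_ineq[of "\<sigma> (y + z + real (Suc k) *\<^sub>R u) - \<sigma> (y + z + real k *\<^sub>R u)"
        "\<sigma> (y + z + real k *\<^sub>R u) - \<sigma> (y + z)"]
      by simp
  qed simp
  have "y + z + real n *\<^sub>R u = x + z" for z using n0 by (simp add: u_def)
  then have "\<forall>z. norm (\<sigma> (x + z) - \<sigma> (y + z)) \<le> real n" using step[of _ n] by metis
  then show ?thesis by blast
qed

text \<open>Moving \<open>y\<close> along its ray from \<open>x\<close> to distance exactly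
  \<open>r\<close> changes \<open>\<sigma>\<close> by less than \<open>\<delta> / 2\<close>. The
  tolerance is used because multiples of a short vector and grid chains meet the distance
  \<open>r\<close> only approximately.\<close>

lemma separation_near_radius:
  fixes \<sigma> :: "'x::real_normed_vector \<Rightarrow> 'h::real_normed_vector"
  assumes uc: "uniformly_continuous_on UNIV \<sigma>" and r: "0 < r" and \<delta>: "0 < \<delta>"
    and sep: "\<And>x y. norm (x - y) = r \<Longrightarrow> \<delta> \<le> norm (\<sigma> x - \<sigma> y)"
  obtains \<eta> where "0 < \<eta>" "\<eta> \<le> r" "\<And>x y. \<bar>norm (x - y) - r\<bar> < \<eta> \<Longrightarrow> \<delta> / 2 \<le> norm (\<sigma> x - \<sigma> y)"
proof -
  obtain \<theta> where \<theta>: "0 < \<theta>" "\<And>x y. norm (x - y) < \<theta> \<Longrightarrow> norm (\<sigma> x - \<sigma> y) < \<delta> / 2"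
    by (rule uniformly_continuous_normE[OF uc half_gt_zero[OF \<delta>]]) (rule that)
  show thesis
  proof (rule that[of "min \<theta> r"])
    fix x y :: 'x assume xy: "\<bar>norm (x - y) - r\<bar> < min \<theta> r"
    define s where "s = norm (x - y)"
    have s: "0 < s" using xy by (simp add: s_def abs_less_iff)
    define w where "w = x + (r / s) *\<^sub>R (y - x)"
    have "norm (x - w) = r" using s r by (simp add: w_def s_def norm_minus_commute)
    then have "\<delta> \<le> norm (\<sigma> x - \<sigma> w)" by (rule sep)
    moreover have "norm (\<sigma> w - \<sigma> y) < \<delta> / 2"
    proof (rule \<theta>(2))
      have "w - y = (r / s - 1) *\<^sub>R (y - x)" by (simp add: w_def algebra_simps)
      then have "norm (w - y) = \<bar>r / s - 1\<bar> * s" by (simp add: s_def norm_minus_commute)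
      also have "\<dots> = \<bar>(r / s - 1) * s\<bar>" using s by (simp add: abs_mult)
      also have "(r / s - 1) * s = r - s" using s by (simp add: field_simps)
      finally show "norm (w - y) < \<theta>" using xy by (simp add: s_def abs_minus_commute)
    qed
    moreover have "norm (\<sigma> x - \<sigma> w) \<le> norm (\<sigma> x - \<sigma> y) + norm (\<sigma> w - \<sigma> y)"
      using norm_triangle_ineq[of "\<sigma> x - \<sigma> y" "\<sigma> y - \<sigma> w"] by (simp add: norm_minus_commute)
    ultimately show "\<delta> / 2 \<le> norm (\<sigma> x - \<sigma> y)" by linarith
  qed (use \<theta> r in auto)
qed

section \<open>The averaged kernel and its realisation by a map\<close>

text \<open>Schoenberg's construction: the mean of the squared displacements is conditionally
  negative definite, hence a squared distance in a Hilbert space. Pointwise bounds on the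
  displacements survive averaging.\<close>

lemma invariant_kernel:
  fixes \<sigma> :: "'x::real_normed_vector \<Rightarrow> 'h::real_inner"
  assumes uc: "uniformly_continuous_on UNIV \<sigma>"
    and G: "countable G" "0 \<in> G" "\<And>x y. \<lbrakk>x \<in> G; y \<in> G\<rbrakk> \<Longrightarrow> x + y \<in> G"
    and orth: "\<And>i j. (e :: nat \<Rightarrow> 'h) i \<bullet> e j = (if i = j then 1 else 0)"
  obtains \<phi> :: "'x \<Rightarrow> 'h" where
    "\<And>x y g. \<lbrakk>x \<in> G; y \<in> G; g \<in> G\<rbrakk> \<Longrightarrow> norm (\<phi> (x + g) - \<phi> (y + g)) = norm (\<phi> x - \<phi> y)"
    "\<And>x y a. \<lbrakk>x \<in> G; y \<in> G; \<And>z. a \<le> norm (\<sigma> (x + z) - \<sigma> (y + z))\<rbrakk> \<Longrightarrow> a \<le> norm (\<phi> x - \<phi> y)"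
    "\<And>x y a. \<lbrakk>x \<in> G; y \<in> G; \<And>z. norm (\<sigma> (x + z) - \<sigma> (y + z)) \<le> a\<rbrakk> \<Longrightarrow> norm (\<phi> x - \<phi> y) \<le> a"
proof -
  \<comment> \<open>As \<open>d\<close> enumerates \<open>G\<close>, invariance under each
    \<open>d n\<close> is invariance under all of \<open>G\<close>.\<close>
  define d where "d = from_nat_into G"
  have d_in: "d n \<in> G" for n unfolding d_def using G(2) by (intro from_nat_into) auto
  have d_to: "d (to_nat_on G x) = x" if "x \<in> G" for x
    unfolding d_def using G(1) that by simp
  define f where "f = (\<lambda>(x, y) z. (norm (\<sigma> (x + z) - \<sigma> (y + z)))\<^sup>2)"
  have bdd: "\<exists>B. \<forall>z. \<bar>f i z\<bar> \<le> B" for i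
  proof -
    obtain x y where i: "i = (x, y)" by fastforce
    obtain B where "\<And>z. norm (\<sigma> (x + z) - \<sigma> (y + z)) \<le> B"
      using uniformly_continuous_bounded_displacement[OF uc, of x y] by blast
    then have "\<forall>z. \<bar>f i z\<bar> \<le> B\<^sup>2" by (simp add: f_def i power_mono)
    then show ?thesis by blast
  qed
  obtain \<mu> where pos: "\<And>(K :: (nat \<times> nat \<times> nat) set) c s lo. \<lbrakk>s ` K \<subseteq> G \<times> G;
        \<And>z. lo \<le> (\<Sum>k\<in>K. c k * f (s k) z)\<rbrakk> \<Longrightarrow> lo \<le> (\<Sum>k\<in>K. c k * \<mu> (s k))"
    and inv: "\<And>i j n. \<lbrakk>i \<in> G \<times> G; j \<in> G \<times> G; \<And>z. f j z = f i (z + d n)\<rbrakk> \<Longrightarrow> \<mu> j = \<mu> i"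
  proof (rule countable_invariant_mean[of "G \<times> G" f d, where 'k = "nat \<times> nat \<times> nat"])
    show "countable (G \<times> G)" using G(1) by simp
  qed (use bdd in \<open>blast intro: that\<close>)+
  have \<mu>_ge: "a \<le> \<mu> (x, y)" if "x \<in> G" "y \<in> G" "\<And>z. a \<le> f (x, y) z" for x y a
    using pos[of "\<lambda>_. (x, y)" "{(0, 0, 0)}" a "\<lambda>_. 1"] that by simp
  have \<mu>_le: "\<mu> (x, y) \<le> a" if "x \<in> G" "y \<in> G" "\<And>z. f (x, y) z \<le> a" for x y a
    using pos[of "\<lambda>_. (x, y)" "{(0, 0, 0)}" "- a" "\<lambda>_. - 1"] that by simp
  have \<mu>_inv: "\<mu> (x + g, y + g) = \<mu> (x, y)" if "x \<in> G" "y \<in> G" "g \<in> G" for x y g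
    by (rule inv[where n = "to_nat_on G g"]) (use that G(3) d_to in \<open>auto simp: f_def add_ac\<close>)
  \<comment> \<open>Invariance under translation by 0 says that \<open>\<mu>\<close> depends only on
    the function \<open>f i\<close>, not on the index.\<close>
  have \<mu>_sym: "\<mu> (x, y) = \<mu> (y, x)" if "x \<in> G" "y \<in> G" for x y
    by (rule inv[where n = "to_nat_on G 0"])
       (use that d_to[OF G(2)] in \<open>auto simp: f_def norm_minus_commute\<close>)
  have \<mu>_refl: "\<mu> (x, x) = 0" if "x \<in> G" for x
    using \<mu>_ge[OF that that, of 0] \<mu>_le[OF that that, of 0] by (simp add: f_def)
  \<comment> \<open>Polarisation with base point 0.\<close>
  define K where "K i j = (\<mu> (d i, 0) + \<mu> (d j, 0) - \<mu> (d i, d j)) / 2" for i j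
  have "pos_semidef K"
    unfolding pos_semidef_def
  proof (intro conjI allI)
    show "K i j = K j i" for i j using \<mu>_sym[OF d_in d_in, of i j] by (simp add: K_def)
    fix n :: nat and c :: "nat \<Rightarrow> real"
    \<comment> \<open>The third index numbers the three terms of \<open>K i j\<close>, which turns
      the quadratic form into one linear combination of values of \<open>\<mu>\<close>.\<close>
    define T where "T = {..<n} \<times> {..<n} \<times> {..<3::nat}"
    define C where "C = (\<lambda>(i, j, l). c i * c j * (if l = (2::nat) then - 1/2 else 1/2))"
    define s where "s = (\<lambda>(i, j, l). if l = (0::nat) then (d i, 0) else if l = 1 then (d j, 0) else (d i, d j))"
    have T_sum: "(\<Sum>k\<in>T. C k * g (s k)) =
        (\<Sum>i<n. \<Sum>j<n. c i * c j * ((g (d i, 0) + g (d j, 0) - g (d i, d j)) / 2))" for g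
    proof -
      have "(\<Sum>k\<in>T. C k * g (s k)) = (\<Sum>i<n. \<Sum>j<n. \<Sum>l<3. C (i, j, l) * g (s (i, j, l)))"
        unfolding T_def by (simp add: sum.cartesian_product split_def)
      moreover have "(\<Sum>l<3. C (i, j, l) * g (s (i, j, l))) =
          c i * c j * ((g (d i, 0) + g (d j, 0) - g (d i, d j)) / 2)" for i j
        by (simp add: C_def s_def eval_nat_numeral algebra_simps add_divide_distrib diff_divide_distrib)
      ultimately show ?thesis by simp
    qed
    have "0 \<le> (\<Sum>k\<in>T. C k * f (s k) z)" for z
    proof -
      \<comment> \<open>Before averaging, for each fixed \<open>z\<close>, the kernel is the Gram
        matrix of these vectors.\<close>
      define a where "a i = \<sigma> (d i + z) - \<sigma> (0 + z)" for i
      have "f (d i, 0) z + f (d j, 0) z - f (d i, d j) z = 2 * (a i \<bullet> a j)" for i j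
        by (simp add: f_def a_def power2_norm_eq_inner algebra_simps inner_commute)
      then have "(\<Sum>k\<in>T. C k * f (s k) z) = (\<Sum>i<n. \<Sum>j<n. c i * c j * (a i \<bullet> a j))"
        using T_sum[of "\<lambda>k. f k z"] by simp
      also have "\<dots> = (\<Sum>i<n. c i *\<^sub>R a i) \<bullet> (\<Sum>j<n. c j *\<^sub>R a j)"
        by (simp only: inner_sum_left inner_scaleR_left)
           (simp only: inner_sum_right inner_scaleR_right sum_distrib_left mult.assoc)
      finally show ?thesis by simp
    qed
    moreover have "s ` T \<subseteq> G \<times> G" by (auto simp: s_def d_in G(2) split: if_splits)
    ultimately have "0 \<le> (\<Sum>k\<in>T. C k * \<mu> (s k))" by (intro pos)
    then show "0 \<le> (\<Sum>i<n. \<Sum>j<n. c i * c j * K i j)" unfolding T_sum K_def .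
  qed
  then obtain v :: "nat \<Rightarrow> 'h" where v: "\<And>i j. v i \<bullet> v j = K i j"
    using pos_semidef_gram[OF _ orth] by blast
  have v_dist: "(norm (v i - v j))\<^sup>2 = \<mu> (d i, d j)" for i j
  proof -
    have "(norm (v i - v j))\<^sup>2 = K i i + K j j - 2 * K i j"
      by (simp add: power2_norm_eq_inner inner_diff_left inner_diff_right v[symmetric] inner_commute)
    then show ?thesis by (simp add: K_def \<mu>_refl[OF d_in] field_simps)
  qed
  define \<phi> where "\<phi> x = v (to_nat_on G x)" for x
  have \<phi>: "(norm (\<phi> x - \<phi> y))\<^sup>2 = \<mu> (x, y)" if "x \<in> G" "y \<in> G" for x y
    using that by (simp add: \<phi>_def v_dist d_to)
  show thesis
  proof (rule that[of \<phi>])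
    fix x y g assume "x \<in> G" "y \<in> G" "g \<in> G"
    then have "(norm (\<phi> (x + g) - \<phi> (y + g)))\<^sup>2 = (norm (\<phi> x - \<phi> y))\<^sup>2"
      by (simp add: \<phi> G(3) \<mu>_inv)
    then show "norm (\<phi> (x + g) - \<phi> (y + g)) = norm (\<phi> x - \<phi> y)" by simp
  next
    fix x y a assume xy: "x \<in> G" "y \<in> G" and a: "\<And>z. a \<le> norm (\<sigma> (x + z) - \<sigma> (y + z))"
    show "a \<le> norm (\<phi> x - \<phi> y)"
    proof (cases "0 \<le> a")
      case True
      then have "a\<^sup>2 \<le> (norm (\<phi> x - \<phi> y))\<^sup>2"
        unfolding \<phi>[OF xy] using a by (intro \<mu>_ge xy) (simp add: f_def power_mono)
      then show ?thesis by (rule power2_le_imp_le) simp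
    next
      case False
      then show ?thesis using norm_ge_zero[of "\<phi> x - \<phi> y"] by linarith
    qed
  next
    fix x y a assume xy: "x \<in> G" "y \<in> G" and a: "\<And>z. norm (\<sigma> (x + z) - \<sigma> (y + z)) \<le> a"
    have "(norm (\<phi> x - \<phi> y))\<^sup>2 \<le> a\<^sup>2"
      unfolding \<phi>[OF xy] using a by (intro \<mu>_le xy) (simp add: f_def power_mono)
    moreover have "0 \<le> a" using a[of 0] norm_ge_zero order_trans by blast
    ultimately show "norm (\<phi> x - \<phi> y) \<le> a" by (rule power2_le_imp_le)
  qed
qed

text \<open>The linear lower bound is proved on \<open>G\<close> for short differences, passes to
  the extension \<open>\<psi>\<close> by density, and then holds on a whole small ball, which is
  rescaled to the unit ball.\<close>

lemma infinite_dimensional_ball_embeds: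
  fixes \<sigma> :: "'x::real_normed_vector \<Rightarrow> 'h::{real_inner, complete_space}"
  assumes sepsp: "separable_space (euclidean :: 'x topology)"
    and uc: "uniformly_continuous_on UNIV \<sigma>"
    and r: "0 < r" and \<eta>: "0 < \<eta>" "\<eta> \<le> r" and \<delta>: "0 < \<delta>"
    and sep: "\<And>x y. \<bar>norm (x - y) - r\<bar> < \<eta> \<Longrightarrow> \<delta> \<le> norm (\<sigma> x - \<sigma> y)"
    and orth: "\<And>i j. (e :: nat \<Rightarrow> 'h) i \<bullet> e j = (if i = j then 1 else 0)"
  shows "uniformly_embeds (cball (0::'x) 1) (cball (0::'h) 1)"
proof -
  obtain G :: "'x set" where G: "countable G" "closure G = UNIV" "0 \<in> G"
    "\<And>x y. \<lbrakk>x \<in> G; y \<in> G\<rbrakk> \<Longrightarrow> x + y \<in> G" "\<And>x. x \<in> G \<Longrightarrow> - x \<in> G"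
    using countable_dense_subgroup[OF sepsp] by blast
  show ?thesis
  proof (rule invariant_kernel[OF uc G(1,3,4) orth])
    fix \<phi> :: "'x \<Rightarrow> 'h"
    assume inv: "\<And>x y g. \<lbrakk>x \<in> G; y \<in> G; g \<in> G\<rbrakk> \<Longrightarrow> norm (\<phi> (x + g) - \<phi> (y + g)) = norm (\<phi> x - \<phi> y)"
      and lo: "\<And>x y a. \<lbrakk>x \<in> G; y \<in> G; \<And>z. a \<le> norm (\<sigma> (x + z) - \<sigma> (y + z))\<rbrakk> \<Longrightarrow> a \<le> norm (\<phi> x - \<phi> y)"
      and hi: "\<And>x y a. \<lbrakk>x \<in> G; y \<in> G; \<And>z. norm (\<sigma> (x + z) - \<sigma> (y + z)) \<le> a\<rbrakk> \<Longrightarrow> norm (\<phi> x - \<phi> y) \<le> a"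
    have uc\<phi>: "uniformly_continuous_on G \<phi>"
      unfolding uniformly_continuous_on_def dist_norm
    proof (intro allI impI)
      fix \<epsilon> :: real assume \<epsilon>: "0 < \<epsilon>"
      obtain \<theta> where \<theta>: "0 < \<theta>" "\<And>x y. norm (x - y) < \<theta> \<Longrightarrow> norm (\<sigma> x - \<sigma> y) < \<epsilon> / 2"
        by (rule uniformly_continuous_normE[OF uc half_gt_zero[OF \<epsilon>]]) (rule that)
      have "norm (\<phi> y - \<phi> x) < \<epsilon>" if "x \<in> G" "y \<in> G" "norm (y - x) < \<theta>" for x y
      proof -
        have "norm (\<phi> y - \<phi> x) \<le> \<epsilon> / 2"
          by (rule hi[OF that(2,1)]) (use \<theta>(2) that(3) in \<open>simp add: less_imp_le\<close>)
        then show ?thesis using \<epsilon> by simp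
      qed
      then show "\<exists>d>0. \<forall>x\<in>G. \<forall>x'\<in>G. norm (x' - x) < d \<longrightarrow> norm (\<phi> x' - \<phi> x) < \<epsilon>" using \<theta>(1) by blast
    qed
    have lowerG: "\<delta> / r * norm (x - y) \<le> norm (\<phi> x - \<phi> y)"
      if x: "x \<in> G" and y: "y \<in> G" and xy: "norm (x - y) < \<eta>" for x y
    proof (cases "x = y")
      case False
      define u where "u = x - y"
      have u: "0 < norm u" "norm u < \<eta>" using False xy by (auto simp: u_def)
      have uG: "real k *\<^sub>R u \<in> G" for k
      proof (induction k)
        case (Suc k)
        have "u \<in> G" using G(4)[OF x G(5)[OF y]] by (simp add: u_def)
        with Suc show ?case using G(4) by (simp add: scaleR_left_distrib)
      qed (use G in simp)
      \<comment> \<open>The length of \<open>n\<close> times \<open>u\<close> falls short of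
        \<open>r\<close> by less than \<open>norm u\<close>, hence by less than
        \<open>\<eta>\<close>.\<close>
      define n where "n = nat \<lfloor>r / norm u\<rfloor>"
      have "real n \<le> r / norm u" unfolding n_def using r u(1) by (intro of_nat_floor) simp
      moreover have "r / norm u < real n + 1" unfolding n_def by linarith
      ultimately have n: "real n * norm u \<le> r" "r - norm u < real n * norm u"
        using u(1) by (simp_all add: field_simps)
      have "\<delta> \<le> norm (\<phi> (real n *\<^sub>R u) - \<phi> 0)"
      proof (rule lo[OF uG G(3)])
        fix z
        have "norm (real n *\<^sub>R u + z - (0 + z)) = real n * norm u" by simp
        then show "\<delta> \<le> norm (\<sigma> (real n *\<^sub>R u + z) - \<sigma> (0 + z))"
          using n u(2) by (intro sep) linarith
      qed
      also have "norm (\<phi> (real k *\<^sub>R u) - \<phi> 0) \<le> real k * norm (\<phi> x - \<phi> y)" for k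
      proof (induction k)
        case (Suc k)
        \<comment> \<open>This translation takes \<open>x\<close> to the multiple
          \<open>k + 1\<close> of \<open>u\<close> and \<open>y\<close> to the multiple
          \<open>k\<close>, so all increments along the chain have the same norm.\<close>
        have "norm (\<phi> (x + (real k *\<^sub>R u + - y)) - \<phi> (y + (real k *\<^sub>R u + - y))) = norm (\<phi> x - \<phi> y)"
          by (intro inv x y G(4) uG G(5))
        then have "norm (\<phi> (real (Suc k) *\<^sub>R u) - \<phi> (real k *\<^sub>R u)) = norm (\<phi> x - \<phi> y)"
          by (simp add: u_def algebra_simps)
        then show ?case using Suc norm_diff_triangle_le[OF order_refl Suc, of "\<phi> (real (Suc k) *\<^sub>R u)"]
          by (simp add: distrib_right)
      qed simp
      finally have "\<delta> \<le> real n * norm (\<phi> x - \<phi> y)" .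
      then have "\<delta> * norm u \<le> (real n * norm u) * norm (\<phi> x - \<phi> y)"
        using mult_right_mono[of _ _ "norm u"] u(1) by (fastforce simp: mult_ac)
      also have "\<dots> \<le> r * norm (\<phi> x - \<phi> y)" using n(1) by (intro mult_right_mono) auto
      finally show ?thesis using r by (simp add: u_def field_simps)
    qed simp
    obtain \<psi> where uc\<psi>: "uniformly_continuous_on (closure G) \<psi>" and \<psi>: "\<And>x. x \<in> G \<Longrightarrow> \<phi> x = \<psi> x"
      using uniformly_continuous_on_extension_on_closure[OF uc\<phi>] by metis
    have lower: "\<delta> / r * norm (x - y) \<le> norm (\<psi> x - \<psi> y)" if xy: "norm (x - y) < \<eta>" for x y
    proof -
      obtain X Y where X: "\<And>n. X n \<in> G" "X \<longlonglongrightarrow> x" and Y: "\<And>n. Y n \<in> G" "Y \<longlonglongrightarrow> y"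
        using G(2) closure_sequential[of x G] closure_sequential[of y G] by auto
      have cont: "isCont \<psi> z" for z
        using uniformly_continuous_imp_continuous[OF uc\<psi>] G(2) by (simp add: continuous_on_eq_continuous_at)
      have "(\<lambda>n. norm (X n - Y n)) \<longlonglongrightarrow> norm (x - y)" by (intro tendsto_norm tendsto_diff X Y)
      then have "\<forall>\<^sub>F n in sequentially. norm (X n - Y n) < \<eta>" using xy by (rule order_tendstoD)
      then have "\<forall>\<^sub>F n in sequentially. \<delta> / r * norm (X n - Y n) \<le> norm (\<psi> (X n) - \<psi> (Y n))"
        by eventually_elim (use lowerG X(1) Y(1) in \<open>simp add: \<psi>[symmetric]\<close>)
      then show ?thesis
        by (rule tendsto_le[OF sequentially_bot, rotated -1])
           (intro tendsto_intros isCont_tendsto_compose[OF cont] X Y)+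
    qed
    obtain \<theta> where \<theta>: "0 < \<theta>" "\<And>x y. norm (x - y) < \<theta> \<Longrightarrow> norm (\<psi> x - \<psi> y) < 1"
      by (rule uniformly_continuous_normE[OF uc\<psi>[unfolded G(2)] zero_less_one]) (rule that)
    \<comment> \<open>\<open>\<rho> < \<theta>\<close> keeps the image within distance 1 of
      \<open>\<psi> 0\<close>; \<open>2 * \<rho> < \<eta>\<close> brings every pair in the scaled
      ball under the lower bound.\<close>
    define \<rho> where "\<rho> = min \<theta> \<eta> / 3"
    have \<rho>: "0 < \<rho>" "\<rho> < \<theta>" "2 * \<rho> < \<eta>" using \<theta>(1) \<eta>(1) by (auto simp: \<rho>_def)
    show "uniformly_embeds (cball (0::'x) 1) (cball (0::'h) 1)"
    proof (rule uniformly_embedsI[of "\<lambda>x. \<psi> (\<rho> *\<^sub>R x) - \<psi> 0"])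
      show "(\<lambda>x. \<psi> (\<rho> *\<^sub>R x) - \<psi> 0) \<in> cball 0 1 \<rightarrow> cball 0 1"
      proof
        fix x :: 'x assume "x \<in> cball 0 1"
        then have "norm (\<rho> *\<^sub>R x - 0) \<le> \<rho>" using \<rho>(1) by (simp add: mult_left_le)
        then have "norm (\<psi> (\<rho> *\<^sub>R x) - \<psi> 0) < 1" using \<rho>(2) by (intro \<theta>(2)) linarith
        then show "\<psi> (\<rho> *\<^sub>R x) - \<psi> 0 \<in> cball 0 1" by simp
      qed
      show "uniformly_continuous_on (cball 0 1) (\<lambda>x. \<psi> (\<rho> *\<^sub>R x) - \<psi> 0)"
        unfolding uniformly_continuous_on_def dist_norm
      proof (intro allI impI)
        fix \<epsilon> :: real assume "0 < \<epsilon>"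
        then obtain \<theta>' where \<theta>': "0 < \<theta>'" "\<And>x y. norm (x - y) < \<theta>' \<Longrightarrow> norm (\<psi> x - \<psi> y) < \<epsilon>"
          by (rule uniformly_continuous_normE[OF uc\<psi>[unfolded G(2)]]) (rule that)
        have "norm (\<psi> (\<rho> *\<^sub>R y) - \<psi> 0 - (\<psi> (\<rho> *\<^sub>R x) - \<psi> 0)) < \<epsilon>"
          if "norm (y - x) < \<theta>' / \<rho>" for x y
        proof -
          have "norm (\<rho> *\<^sub>R y - \<rho> *\<^sub>R x) = \<rho> * norm (y - x)"
            using \<rho>(1) by (simp add: scaleR_diff_right[symmetric])
          then have "norm (\<rho> *\<^sub>R y - \<rho> *\<^sub>R x) < \<theta>'" using that \<rho>(1) by (simp add: field_simps)
          then show ?thesis using \<theta>'(2) by simp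
        qed
        moreover have "0 < \<theta>' / \<rho>" using \<theta>'(1) \<rho>(1) by simp
        ultimately show "\<exists>d>0. \<forall>x\<in>cball 0 1. \<forall>x'\<in>cball 0 1. norm (x' - x) < d \<longrightarrow>
            norm (\<psi> (\<rho> *\<^sub>R x') - \<psi> 0 - (\<psi> (\<rho> *\<^sub>R x) - \<psi> 0)) < \<epsilon>" by blast
      qed
      show "0 < \<delta> / r * \<rho>" using r \<delta> \<rho> by simp
      fix x y :: 'x assume xy: "x \<in> cball 0 1" "y \<in> cball 0 1"
      have eq: "norm (\<rho> *\<^sub>R x - \<rho> *\<^sub>R y) = \<rho> * norm (x - y)"
        using \<rho>(1) by (simp add: scaleR_diff_right[symmetric])
      also have "\<dots> \<le> \<rho> * 2" using xy \<rho>(1) norm_triangle_ineq4[of x y] by (intro mult_left_mono) auto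
      finally have "\<delta> / r * norm (\<rho> *\<^sub>R x - \<rho> *\<^sub>R y) \<le> norm (\<psi> (\<rho> *\<^sub>R x) - \<psi> (\<rho> *\<^sub>R y))"
        using \<rho>(3) by (intro lower) linarith
      then show "\<delta> / r * \<rho> * dist x y \<le> dist (\<psi> (\<rho> *\<^sub>R x) - \<psi> 0) (\<psi> (\<rho> *\<^sub>R y) - \<psi> 0)"
        unfolding eq by (simp add: dist_norm mult.assoc)
    qed
  qed
qed

theorem theorem6:
  fixes \<sigma> :: "'x::banach \<Rightarrow> 'h::{real_inner, complete_space}"
    and r :: real
  assumes "separable_space (euclidean :: 'x topology)"
    and "uniformly_continuous_on UNIV \<sigma>"
    and "r > 0"
    and "(INF (x, y) \<in> {(x, y). norm (x - y) = r}. ereal (norm (\<sigma> x - \<sigma> y))) > 0"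
  shows "uniformly_embeds (cball (0::'x) 1) (cball (0::'h) 1)"
proof -
  \<comment> \<open>The infimum is infinite if \<open>X\<close> is trivial, so a real number
    strictly below it is chosen.\<close>
  obtain \<delta>' where \<delta>': "0 < ereal \<delta>'"
    "ereal \<delta>' < (INF (x, y) \<in> {(x, y). norm (x - y) = r}. ereal (norm (\<sigma> x - \<sigma> y)))"
    using ereal_dense2[OF assms(4)] by blast
  have "\<delta>' \<le> norm (\<sigma> x - \<sigma> y)" if "norm (x - y) = r" for x y
  proof -
    have "(INF (x, y) \<in> {(x, y). norm (x - y) = r}. ereal (norm (\<sigma> x - \<sigma> y))) \<le> ereal (norm (\<sigma> x - \<sigma> y))"
      by (rule INF_lower2[of "(x, y)"]) (use that in auto)
    with \<delta>'(2) have "ereal \<delta>' < ereal (norm (\<sigma> x - \<sigma> y))" by (rule less_le_trans)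
    then show ?thesis by simp
  qed
  then obtain \<eta> where \<eta>: "0 < \<eta>" "\<eta> \<le> r"
    and sep: "\<And>x y. \<bar>norm (x - y) - r\<bar> < \<eta> \<Longrightarrow> \<delta>' / 2 \<le> norm (\<sigma> x - \<sigma> y)"
    using separation_near_radius[OF assms(2,3), of \<delta>'] \<delta>'(1) by auto
  have \<delta>: "0 < \<delta>' / 2" using \<delta>'(1) by simp
  show ?thesis
  proof (rule orthonormal_sequence_or_basis[where 'h='h])
    fix e :: "nat \<Rightarrow> 'h" assume e: "\<And>i j. e i \<bullet> e j = (if i = j then 1 else 0)"
    show ?thesis
      by (rule infinite_dimensional_ball_embeds[OF assms(1-3) \<eta> \<delta>, where e = e]) (fact sep e)+
  next
    fix m and e :: "nat \<Rightarrow> 'h"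
    assume e: "\<And>i j. \<lbrakk>i < m; j < m\<rbrakk> \<Longrightarrow> e i \<bullet> e j = (if i = j then 1 else 0)" "span (e ` {..<m}) = UNIV"
    obtain B :: "'x set" where "independent B" "UNIV \<subseteq> span B"
      by (rule maximal_independent_subset) (rule that)
    then have B: "independent B" "span B = UNIV" by auto
    show ?thesis
    proof (cases "finite B \<and> card B \<le> m")
      case True
      then show ?thesis by (intro finite_dimensional_ball_embeds[OF B, where e = e and m = m]) (auto simp: e(1))
    next
      case False
      \<comment> \<open>A basis that is infinite or has more than \<open>m\<close> elements contains
        the \<open>m + 1\<close> independent vectors that the Hex argument rules out.\<close>
      then obtain C where C: "C \<subseteq> B" "finite C" "card C = Suc m"
        by (metis infinite_arbitrarily_large obtain_subset_with_card_n not_less_eq_eq)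
      obtain b where b: "bij_betw b {..<Suc m} C"
        using ex_bij_betw_nat_finite[OF C(2)] C(3) unfolding atLeast0LessThan by auto
      have indep: "\<forall>i<Suc m. c i = 0" if "(\<Sum>i<Suc m. c i *\<^sub>R b i) = 0" for c
        by (rule independent_indexed[OF independent_mono[OF B(1) C(1)] C(2) b that])
      have False
        by (rule finite_dimensional_separation_contradiction[OF assms(2,3) \<eta>(1) \<delta>,
              where e = e and b = b and m = m]) (fact sep e indep)+
      then show ?thesis ..
    qed
  qed
qed

end
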